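(* Let $R$ be an integral domain which is a Hilbert ring. Then any radical ideal $I\subset R[X]$ which is a finite intersection of G-ideals of $R[X]$ is power stable.
   Context: All rings are commutative with identity. An ideal $I$ of $R[X]$ is called power stable if $I^t\cap R=(I\cap R)^t$ for all $t\geq 1$. An integral domain $D$ is a G-domain if its quotient field is finitely generated as a ring over $D$. A prime ideal $P$ of a ring $S$ is a G-ideal if $S/P$ is a G-domain. A ring is a Hilbert ring if every G-ideal in it is maximal. *)

theory Defs
  imports "HOL-Algebra.UnivPoly" "HOL-Algebra.QuotRing" "HOL-Algebra.Ideal_Product"
    "HOL-Algebra.Generated_Rings"
begin

section \<open>The quotient field of a domain\<close>

definition frac_rel :: "('a, 'b) ring_scheme \<Rightarrow> (('a \<times> 'a) \<times> ('a \<times> 'a)) set" where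
  "frac_rel D =
     {((a, b), (c, d)). a \<in> carrier D \<and> b \<in> carrier D - {\<zero>\<^bsub>D\<^esub>} \<and>
        c \<in> carrier D \<and> d \<in> carrier D - {\<zero>\<^bsub>D\<^esub>} \<and> a \<otimes>\<^bsub>D\<^esub> d = c \<otimes>\<^bsub>D\<^esub> b}"

definition fraction :: "('a, 'b) ring_scheme \<Rightarrow> 'a \<Rightarrow> 'a \<Rightarrow> ('a \<times> 'a) set" where
  "fraction D a b = frac_rel D `` {(a, b)}"

definition quotient_field :: "('a, 'b) ring_scheme \<Rightarrow> ('a \<times> 'a) set ring" where
  "quotient_field D =
     \<lparr>carrier = (carrier D \<times> (carrier D - {\<zero>\<^bsub>D\<^esub>})) // frac_rel D,
      mult = (\<lambda>x y. \<Union>(a, b)\<in>x. \<Union>(c, d)\<in>y. fraction D (a \<otimes>\<^bsub>D\<^esub> c) (b \<otimes>\<^bsub>D\<^esub> d)),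
      one = fraction D \<one>\<^bsub>D\<^esub> \<one>\<^bsub>D\<^esub>,
      zero = fraction D \<zero>\<^bsub>D\<^esub> \<one>\<^bsub>D\<^esub>,
      add = (\<lambda>x y. \<Union>(a, b)\<in>x. \<Union>(c, d)\<in>y.
               fraction D ((a \<otimes>\<^bsub>D\<^esub> d) \<oplus>\<^bsub>D\<^esub> (c \<otimes>\<^bsub>D\<^esub> b)) (b \<otimes>\<^bsub>D\<^esub> d))\<rparr>"


section \<open>G-domains, G-ideals and Hilbert rings\<close>

definition G_domain :: "('a, 'b) ring_scheme \<Rightarrow> bool" where
  "G_domain D \<longleftrightarrow> domain D \<and>
     (\<exists>S. finite S \<and> S \<subseteq> carrier (quotient_field D) \<and>
        generate_ring (quotient_field D) ((\<lambda>a. fraction D a \<one>\<^bsub>D\<^esub>) ` carrier D \<union> S)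
          = carrier (quotient_field D))"

definition G_ideal :: "'a set \<Rightarrow> ('a, 'b) ring_scheme \<Rightarrow> bool" where
  "G_ideal P S \<longleftrightarrow> primeideal P S \<and> G_domain (S Quot P)"

definition hilbert_ring :: "('a, 'b) ring_scheme \<Rightarrow> bool" where
  "hilbert_ring S \<longleftrightarrow> cring S \<and> (\<forall>P. G_ideal P S \<longrightarrow> maximalideal P S)"


section \<open>Radical ideals and power stable ideals\<close>

definition radical_ideal :: "'a set \<Rightarrow> ('a, 'b) ring_scheme \<Rightarrow> bool" where
  "radical_ideal I S \<longleftrightarrow> ideal I S \<and>
     {a \<in> carrier S. \<exists>n::nat. n \<ge> 1 \<and> a [^]\<^bsub>S\<^esub> n \<in> I} = I"

text \<open>The intersection of an ideal of \<open>R[X]\<close> with \<open>R\<close>, where \<open>R\<close> is identified with the constant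
  polynomials in \<^term>\<open>UP R\<close>.\<close>

definition contraction :: "('a, 'b) ring_scheme \<Rightarrow> (nat \<Rightarrow> 'a) set \<Rightarrow> 'a set" where
  "contraction R J = {r \<in> carrier R. monom (UP R) r 0 \<in> J}"

text \<open>Powers are taken in the monoid of ideals: the multiplication of \<^term>\<open>ideals_set S\<close> is the product of ideals.\<close>

definition power_stable :: "('a, 'b) ring_scheme \<Rightarrow> (nat \<Rightarrow> 'a) set \<Rightarrow> bool" where
  "power_stable R I \<longleftrightarrow> ideal I (UP R) \<and>
     (\<forall>t::nat. t \<ge> 1 \<longrightarrow>
        contraction R (I [^]\<^bsub>ideals_set (UP R)\<^esub> t) = contraction R I [^]\<^bsub>ideals_set R\<^esub> t)"

end

theory Submission
  imports Defs
begin

text \<open>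
  A prime \<open>P\<close> of \<open>S\<close> is a G-ideal iff some \<open>s \<notin> P\<close> has a power divisible modulo \<open>P\<close> by each given
  \<open>d \<notin> P\<close>. Such an \<open>s\<close> for a prime \<open>Q\<close> of \<open>R[X]\<close> yields one for \<open>M = Q \<inter> R\<close>, by pseudo-division by
  an \<open>f \<in> Q\<close> of least degree outside \<open>M[X]\<close>. As \<open>R\<close> is a Hilbert ring, \<open>M\<close> is then maximal, so that
  \<open>Q \<subseteq> M[X] + f R[X]\<close> with \<open>f\<close> monic of positive degree or zero. Hence
  \<open>Q\<^sup>t \<subseteq> M\<^sup>t[X] + f R[X]\<close>, and the constants in the latter ideal lie in \<open>M\<^sup>t\<close>. So \<open>I\<^sup>t \<inter> R\<close> lies in
  the intersection of the \<open>M\<^sup>t\<close>, which is the \<open>t\<close>-th power of \<open>I \<inter> R\<close> because distinct maximal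
  ideals are comaximal.
\<close>

section \<open>G-ideals without fractions\<close>

text \<open>The delicate point is the descent of the witness from \<open>Q\<close> to
  \<open>M\<close>: the relation for \<open>Q\<close> involves polynomials, and membership in
  \<open>Q\<close> says something about coefficients only when it forces membership in M[X]. If Q =
  M[X] this is automatic, and the last coefficient of \<open>s\<close> outside \<open>M\<close>
  serves as witness. Otherwise R[X]/Q is algebraic over R/M, so some multiple of \<open>s\<close> is
  congruent modulo \<open>Q\<close> to a constant \<open>c\<close> outside \<open>M\<close>.
  Replacing \<open>s\<close> by \<open>c\<close> and reducing the cofactor by \<open>f\<close>
  leaves an element of \<open>Q\<close> of degree below that of \<open>f\<close>, which must lie in
  M[X]. The reduction costs a power of the leading coefficient \<open>a\<close> of \<open>f\<close>,
  hence the witness \<open>a \<otimes> c\<close>. In the second half M^t is in general not prime, so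
  degree arguments by cancellation fail modulo M^t. A leading coefficient equal to 1 replaces them,
  and it is available because R/M is a field.\<close>

lemma (in "domain") fraction_equiv:
  "equiv (carrier R \<times> (carrier R - {\<zero>})) (frac_rel R)"
proof (rule equivI)
  show "frac_rel R \<subseteq> (carrier R \<times> (carrier R - {\<zero>})) \<times> (carrier R \<times> (carrier R - {\<zero>}))"
    by (auto simp: frac_rel_def)
  show "refl_on (carrier R \<times> (carrier R - {\<zero>})) (frac_rel R)"
    by (auto simp: refl_on_def frac_rel_def)
  show "sym (frac_rel R)"
    by (auto simp: sym_def frac_rel_def)
  show "trans (frac_rel R)"
  proof (rule transI, clarsimp simp: frac_rel_def)
    fix a b c d e f
    assume c: "a \<in> carrier R" "b \<in> carrier R" "c \<in> carrier R" "d \<in> carrier R"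
      "e \<in> carrier R" "f \<in> carrier R" and d: "d \<noteq> \<zero>"
      and 1: "a \<otimes> d = c \<otimes> b" and 2: "c \<otimes> f = e \<otimes> d"
    \<comment> \<open>The middle denominator \<open>d\<close> has to be cancelled, which uses that
      \<open>R\<close> is a domain.\<close>
    have "d \<otimes> (a \<otimes> f) = (a \<otimes> d) \<otimes> f" using c by (simp add: m_ac)
    also have "\<dots> = (c \<otimes> b) \<otimes> f" by (simp only: 1)
    also have "\<dots> = (c \<otimes> f) \<otimes> b" using c by (simp add: m_ac)
    also have "\<dots> = (e \<otimes> d) \<otimes> b" by (simp only: 2)
    also have "\<dots> = d \<otimes> (e \<otimes> b)" using c by (simp add: m_ac)
    finally show "a \<otimes> f = e \<otimes> b" using c d m_lcancel by simp
  qed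
qed

lemma (in "domain") fraction_eq_iff:
  assumes "a \<in> carrier R" "b \<in> carrier R - {\<zero>}" "c \<in> carrier R" "d \<in> carrier R - {\<zero>}"
  shows "fraction R a b = fraction R c d \<longleftrightarrow> a \<otimes> d = c \<otimes> b"
  using eq_equiv_class_iff[OF fraction_equiv, of "(a, b)" "(c, d)"] assms
  by (auto simp: fraction_def frac_rel_def)

text \<open>The operations of \<open>quotient_field\<close> run over all representatives of a class.
  This turns each representative into an equation between fractions, with the side conditions that
  \<open>frac_rel\<close> carries.\<close>

lemma (in "domain") mem_fraction:
  "(c, d) \<in> fraction R a b \<longleftrightarrow> a \<in> carrier R \<and> b \<in> carrier R - {\<zero>} \<and> c \<in> carrier R
     \<and> d \<in> carrier R - {\<zero>} \<and> fraction R c d = fraction R a b"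
proof -
  have "(c, d) \<in> fraction R a b \<longleftrightarrow> a \<in> carrier R \<and> b \<in> carrier R - {\<zero>} \<and> c \<in> carrier R
     \<and> d \<in> carrier R - {\<zero>} \<and> a \<otimes> d = c \<otimes> b"
    by (simp add: fraction_def frac_rel_def)
  thus ?thesis using fraction_eq_iff[of a b c d] by metis
qed

lemma (in "domain") carrier_quotient_field:
  "carrier (quotient_field R) = {fraction R a b | a b. a \<in> carrier R \<and> b \<in> carrier R - {\<zero>}}"
  by (auto simp: quotient_field_def quotient_def fraction_def)

lemma (in "domain") mult_fraction:
  assumes "a \<in> carrier R" "b \<in> carrier R - {\<zero>}" "c \<in> carrier R" "d \<in> carrier R - {\<zero>}"
  shows "fraction R a b \<otimes>\<^bsub>quotient_field R\<^esub> fraction R c d = fraction R (a \<otimes> c) (b \<otimes> d)"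
proof -
  have eq: "fraction R (a' \<otimes> c') (b' \<otimes> d') = fraction R (a \<otimes> c) (b \<otimes> d)"
    if "(a', b') \<in> fraction R a b" "(c', d') \<in> fraction R c d" for a' b' c' d'
  proof -
    have car: "a' \<in> carrier R" "b' \<in> carrier R - {\<zero>}" "c' \<in> carrier R" "d' \<in> carrier R - {\<zero>}"
      and e: "a' \<otimes> b = a \<otimes> b'" "c' \<otimes> d = c \<otimes> d'"
      using that assms by (auto simp: mem_fraction fraction_eq_iff)
    have car': "b' \<in> carrier R" "d' \<in> carrier R" "b \<in> carrier R" "d \<in> carrier R"
      using car assms by auto
    have "(a' \<otimes> c') \<otimes> (b \<otimes> d) = (a' \<otimes> b) \<otimes> (c' \<otimes> d)" using car(1,3) car' assms(1,3) by algebra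
    also have "\<dots> = (a \<otimes> c) \<otimes> (b' \<otimes> d')" unfolding e using car(1,3) car' assms(1,3) by algebra
    finally show ?thesis
      using car assms integral by (subst fraction_eq_iff) auto
  qed
  have "(\<Union>(a', b')\<in>fraction R a b. \<Union>(c', d')\<in>fraction R c d. fraction R (a' \<otimes> c') (b' \<otimes> d'))
      = (\<Union>p\<in>fraction R a b. \<Union>q\<in>fraction R c d. fraction R (a \<otimes> c) (b \<otimes> d))"
    using eq by fastforce
  also have "\<dots> = fraction R (a \<otimes> c) (b \<otimes> d)"
  proof -
    \<comment> \<open>A union of a constant is that constant only over nonempty index sets.\<close>
    have "fraction R a b \<noteq> {}" "fraction R c d \<noteq> {}"
      using assms mem_fraction[of a b a b] mem_fraction[of c d c d] by auto
    thus ?thesis by auto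
  qed
  finally show ?thesis by (simp add: quotient_field_def)
qed

lemma (in "domain") add_fraction:
  assumes "a \<in> carrier R" "b \<in> carrier R - {\<zero>}" "c \<in> carrier R" "d \<in> carrier R - {\<zero>}"
  shows "fraction R a b \<oplus>\<^bsub>quotient_field R\<^esub> fraction R c d
    = fraction R (a \<otimes> d \<oplus> c \<otimes> b) (b \<otimes> d)"
proof -
  have eq: "fraction R (a' \<otimes> d' \<oplus> c' \<otimes> b') (b' \<otimes> d') = fraction R (a \<otimes> d \<oplus> c \<otimes> b) (b \<otimes> d)"
    if "(a', b') \<in> fraction R a b" "(c', d') \<in> fraction R c d" for a' b' c' d'
  proof -
    have car: "a' \<in> carrier R" "b' \<in> carrier R - {\<zero>}" "c' \<in> carrier R" "d' \<in> carrier R - {\<zero>}"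
      and e: "a' \<otimes> b = a \<otimes> b'" "c' \<otimes> d = c \<otimes> d'"
      using that assms by (auto simp: mem_fraction fraction_eq_iff)
    have car': "b' \<in> carrier R" "d' \<in> carrier R" "b \<in> carrier R" "d \<in> carrier R"
      using car assms by auto
    have "(a' \<otimes> d' \<oplus> c' \<otimes> b') \<otimes> (b \<otimes> d) = (a' \<otimes> b) \<otimes> d' \<otimes> d \<oplus> (c' \<otimes> d) \<otimes> b' \<otimes> b"
      using car(1,3) car' assms(1,3) by algebra
    also have "\<dots> = (a \<otimes> d \<oplus> c \<otimes> b) \<otimes> (b' \<otimes> d')" unfolding e using car(1,3) car' assms(1,3) by algebra
    finally show ?thesis
      using car assms integral by (subst fraction_eq_iff) auto
  qed
  have "(\<Union>(a', b')\<in>fraction R a b. \<Union>(c', d')\<in>fraction R c d.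
          fraction R (a' \<otimes> d' \<oplus> c' \<otimes> b') (b' \<otimes> d'))
      = (\<Union>p\<in>fraction R a b. \<Union>q\<in>fraction R c d. fraction R (a \<otimes> d \<oplus> c \<otimes> b) (b \<otimes> d))"
    using eq by fastforce
  also have "\<dots> = fraction R (a \<otimes> d \<oplus> c \<otimes> b) (b \<otimes> d)"
  proof -
    have "fraction R a b \<noteq> {}" "fraction R c d \<noteq> {}"
      using assms mem_fraction[of a b a b] mem_fraction[of c d c d] by auto
    thus ?thesis by auto
  qed
  finally show ?thesis by (simp add: quotient_field_def)
qed

text \<open>No ring laws for \<open>quotient_field R\<close> are established, so the negative is
  evaluated from its definition as a definite description; this is why its uniqueness has to be
  shown as well.\<close>

lemma (in "domain") a_inv_fraction:
  assumes "a \<in> carrier R" "b \<in> carrier R - {\<zero>}"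
  shows "\<ominus>\<^bsub>quotient_field R\<^esub> fraction R a b = fraction R (\<ominus> a) b"
proof -
  let ?K = "quotient_field R"
  have zero: "\<zero>\<^bsub>?K\<^esub> = fraction R \<zero> \<one>" by (simp add: quotient_field_def)
  have bb: "b \<otimes> b \<in> carrier R - {\<zero>}" using assms integral by auto
  have z: "fraction R c d = \<zero>\<^bsub>?K\<^esub> \<longleftrightarrow> c = \<zero>" if "c \<in> carrier R" "d \<in> carrier R - {\<zero>}" for c d
    unfolding zero using that by (subst fraction_eq_iff) auto
  have "\<ominus>\<^bsub>?K\<^esub> fraction R a b = (THE y. y \<in> carrier ?K \<and>
      fraction R a b \<oplus>\<^bsub>?K\<^esub> y = \<zero>\<^bsub>?K\<^esub> \<and> y \<oplus>\<^bsub>?K\<^esub> fraction R a b = \<zero>\<^bsub>?K\<^esub>)"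
    by (simp add: a_inv_def m_inv_def)
  also have "\<dots> = fraction R (\<ominus> a) b"
  proof (rule the_equality, goal_cases)
    case 1
    have "b \<in> carrier R" using assms by simp
    hence "a \<otimes> b \<oplus> \<ominus> a \<otimes> b = \<zero>" "\<ominus> a \<otimes> b \<oplus> a \<otimes> b = \<zero>"
      using assms(1) by (simp_all add: l_minus r_neg l_neg)
    thus ?case
      using assms bb by (auto simp: add_fraction z carrier_quotient_field)
  next
    case y: (2 y)
    then obtain c d where cd: "y = fraction R c d" "c \<in> carrier R" "d \<in> carrier R - {\<zero>}"
      by (auto simp: carrier_quotient_field)
    have "b \<otimes> d \<in> carrier R - {\<zero>}" using assms cd integral by auto
    hence "a \<otimes> d \<oplus> c \<otimes> b = \<zero>" using y cd assms by (auto simp: add_fraction z)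
    hence "c \<otimes> b = \<ominus> (a \<otimes> d)" using cd assms by (intro sum_zero_eq_neg) (auto simp: a_comm)
    also have "\<dots> = \<ominus> a \<otimes> d" using cd assms by (simp add: l_minus)
    finally show ?case using cd assms by (simp add: fraction_eq_iff)
  qed
  finally show ?thesis .
qed

text \<open>The product of the denominators works. Finitely many generators of the quotient field
  are thereby condensed into the single generator 1/s.\<close>

lemma (in "domain") finite_common_denominator:
  assumes "finite S" "S \<subseteq> carrier (quotient_field R)"
  shows "\<exists>s\<in>carrier R - {\<zero>}. \<forall>x\<in>S. \<exists>e\<in>carrier R. x = fraction R e s"
  using assms
proof (induction S rule: finite_induct)
  case empty
  show ?case using one_not_zero by (auto intro!: bexI[of _ \<one>])
next
  case (insert x S)
  then obtain s where s: "s \<in> carrier R - {\<zero>}" "\<forall>x\<in>S. \<exists>e\<in>carrier R. x = fraction R e s"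
    by auto
  obtain a b where ab: "a \<in> carrier R" "b \<in> carrier R - {\<zero>}" "x = fraction R a b"
    using insert.prems by (auto simp: carrier_quotient_field)
  have sb: "s \<otimes> b \<in> carrier R - {\<zero>}" using s ab integral by auto
  have "x = fraction R (a \<otimes> s) (s \<otimes> b)"
    unfolding ab(3) using ab s sb by (subst fraction_eq_iff) (auto simp: m_ac)
  moreover have "\<exists>e\<in>carrier R. y = fraction R e (s \<otimes> b)" if y: "y \<in> S" for y
  proof -
    obtain e where "e \<in> carrier R" "y = fraction R e s" using s y by blast
    hence "y = fraction R (e \<otimes> b) (s \<otimes> b)" using s ab sb by (simp add: fraction_eq_iff m_ac)
    thus ?thesis using \<open>e \<in> carrier R\<close> ab by auto
  qed
  ultimately show ?case using sb s ab by (intro bexI[of _ "s \<otimes> b"]) auto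
qed

text \<open>The quotient field is finitely generated exactly when powers of one \<open>s\<close>
  suffice as denominators. Since 1/d has such a form iff \<open>d\<close> divides a power of
  \<open>s\<close>, fractions disappear from the criterion.\<close>

lemma (in "domain") G_domain_iff:
  "G_domain R \<longleftrightarrow> (\<exists>s\<in>carrier R - {\<zero>}. \<forall>d\<in>carrier R - {\<zero>}.
     \<exists>n::nat. \<exists>e\<in>carrier R. d \<otimes> e = s [^] n)"
proof
  let ?K = "quotient_field R"
  let ?i = "(\<lambda>a. fraction R a \<one>) ` carrier R"
  assume "G_domain R"
  then obtain S where S: "finite S" "S \<subseteq> carrier ?K" "generate_ring ?K (?i \<union> S) = carrier ?K"
    by (auto simp: G_domain_def)
  obtain s where s: "s \<in> carrier R - {\<zero>}" "\<forall>x\<in>S. \<exists>e\<in>carrier R. x = fraction R e s"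
    using finite_common_denominator[OF S(1,2)] by blast
  have pow: "s [^] n \<in> carrier R - {\<zero>}" for n :: nat
    using s by (induction n) (auto simp: integral_iff)
  \<comment> \<open>Fractions over powers of \<open>s\<close> contain the generators and are closed
    under the ring operations.\<close>
  have gen: "\<exists>n::nat. \<exists>e\<in>carrier R. x = fraction R e (s [^] n)"
    if "x \<in> generate_ring ?K (?i \<union> S)" for x
    using that
  proof induction
    case one
    show ?case by (intro exI[of _ 0] bexI[of _ \<one>]) (auto simp: quotient_field_def)
  next
    case (incl h)
    then consider a where "a \<in> carrier R" "h = fraction R a \<one>" | "h \<in> S" by auto
    thus ?case
    proof cases
      case 1 thus ?thesis by (intro exI[of _ 0] bexI[of _ a]) auto
    next
      case 2
      then obtain e where "e \<in> carrier R" "h = fraction R e s" using s by auto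
      thus ?thesis using s by (intro exI[of _ 1] bexI[of _ e]) auto
    qed
  next
    case (a_inv h)
    then obtain n :: nat and e where "e \<in> carrier R" "h = fraction R e (s [^] n)" by auto
    thus ?case using pow by (intro exI[of _ n] bexI[of _ "\<ominus> e"]) (auto simp: a_inv_fraction)
  next
    case (eng_add h1 h2)
    then obtain n m :: nat and d e where "e \<in> carrier R" "h1 = fraction R e (s [^] n)"
       "d \<in> carrier R" "h2 = fraction R d (s [^] m)" by auto
    thus ?case using pow s
      by (intro exI[of _ "n + m"] bexI[of _ "e \<otimes> s [^] m \<oplus> d \<otimes> s [^] n"])
        (auto simp: add_fraction nat_pow_mult)
  next
    case (eng_mult h1 h2)
    then obtain n m :: nat and d e where "e \<in> carrier R" "h1 = fraction R e (s [^] n)"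
       "d \<in> carrier R" "h2 = fraction R d (s [^] m)" by auto
    thus ?case using pow s
      by (intro exI[of _ "n + m"] bexI[of _ "e \<otimes> d"]) (auto simp: mult_fraction nat_pow_mult)
  qed
  show "\<exists>s\<in>carrier R - {\<zero>}. \<forall>d\<in>carrier R - {\<zero>}. \<exists>n::nat. \<exists>e\<in>carrier R. d \<otimes> e = s [^] n"
  proof (intro bexI[OF _ s(1)] ballI)
    fix d assume d: "d \<in> carrier R - {\<zero>}"
    have "fraction R \<one> d \<in> generate_ring ?K (?i \<union> S)"
      unfolding S(3) carrier_quotient_field using d by auto
    from gen[OF this] obtain n :: nat and e where e: "e \<in> carrier R"
      "fraction R \<one> d = fraction R e (s [^] n)" by auto
    have "\<one> \<otimes> s [^] n = e \<otimes> d" using fraction_eq_iff[of \<one> d e "s [^] n"] d e pow by auto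
    thus "\<exists>n::nat. \<exists>e\<in>carrier R. d \<otimes> e = s [^] n"
      using d e s by (intro exI[of _ n] bexI[of _ e]) (auto simp: m_comm)
  qed
next
  let ?K = "quotient_field R"
  let ?i = "(\<lambda>a. fraction R a \<one>) ` carrier R"
  assume "\<exists>s\<in>carrier R - {\<zero>}. \<forall>d\<in>carrier R - {\<zero>}. \<exists>n::nat. \<exists>e\<in>carrier R. d \<otimes> e = s [^] n"
  then obtain s where s: "s \<in> carrier R - {\<zero>}"
    and div: "\<And>d. d \<in> carrier R - {\<zero>} \<Longrightarrow> \<exists>n::nat. \<exists>e\<in>carrier R. d \<otimes> e = s [^] n" by blast
  have pow: "s [^] n \<in> carrier R - {\<zero>}" for n :: nat
    using s by (induction n) (auto simp: integral_iff)
  have one: "\<one> \<in> carrier R - {\<zero>}" by simp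
  let ?G = "generate_ring ?K (?i \<union> {fraction R \<one> s})"
  have fr: "fraction R a b \<in> carrier ?K" if "a \<in> carrier R" "b \<in> carrier R - {\<zero>}" for a b
    using that by (auto simp: carrier_quotient_field)
  have "x \<in> carrier ?K" if "x \<in> ?G" for x
    using that
  proof induction
    case one
    show ?case using fr[OF one_closed one] by (simp add: quotient_field_def)
  next
    case (incl h)
    thus ?case using fr s one by auto
  next
    case (a_inv h)
    then obtain a b where "h = fraction R a b" "a \<in> carrier R" "b \<in> carrier R - {\<zero>}"
      by (auto simp: carrier_quotient_field)
    thus ?case using fr by (simp add: a_inv_fraction)
  next
    case (eng_add h1 h2)
    then obtain a b c d where "h1 = fraction R a b" "a \<in> carrier R" "b \<in> carrier R - {\<zero>}"
      "h2 = fraction R c d" "c \<in> carrier R" "d \<in> carrier R - {\<zero>}"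
      by (auto simp: carrier_quotient_field)
    thus ?case using integral by (auto simp: add_fraction intro!: fr)
  next
    case (eng_mult h1 h2)
    then obtain a b c d where "h1 = fraction R a b" "a \<in> carrier R" "b \<in> carrier R - {\<zero>}"
      "h2 = fraction R c d" "c \<in> carrier R" "d \<in> carrier R - {\<zero>}"
      by (auto simp: carrier_quotient_field)
    thus ?case using integral by (auto simp: mult_fraction intro!: fr)
  qed
  moreover have "x \<in> ?G" if x: "x \<in> carrier ?K" for x
  proof -
    obtain a b where ab: "a \<in> carrier R" "b \<in> carrier R - {\<zero>}" "x = fraction R a b"
      using x unfolding carrier_quotient_field by blast
    obtain n :: nat and e where e: "e \<in> carrier R" "b \<otimes> e = s [^] n" using div ab by blast
    have gen: "fraction R c (s [^] m) \<in> ?G" if "c \<in> carrier R" for c and m :: nat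
    proof (induction m)
      case 0
      show ?case using that by (auto intro: generate_ring.incl)
    next
      case (Suc m)
      have "fraction R \<one> s \<in> ?G" by (auto intro: generate_ring.incl)
      with Suc have "fraction R c (s [^] m) \<otimes>\<^bsub>?K\<^esub> fraction R \<one> s \<in> ?G"
        by (rule generate_ring.eng_mult)
      thus ?case using that pow s by (simp add: mult_fraction)
    qed
    \<comment> \<open>If \<open>b\<close> divides s^n with cofactor \<open>e\<close>, then a/b = (a
      e)/s^n.\<close>
    have "a \<otimes> s [^] n = (a \<otimes> e) \<otimes> b" unfolding e(2)[symmetric] using ab e by (simp add: m_ac)
    hence "x = fraction R (a \<otimes> e) (s [^] n)"
      using ab e pow by (simp add: fraction_eq_iff)
    thus ?thesis using gen ab e by simp
  qed
  ultimately have "?G = carrier ?K" by blast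
  moreover have "{fraction R \<one> s} \<subseteq> carrier ?K" using fr s by auto
  ultimately show "G_domain R"
    unfolding G_domain_def using domain_axioms by blast
qed

section \<open>Passage from \<open>S Quot P\<close> to representatives in \<open>S\<close>\<close>

lemma zero_FactRing: "\<zero>\<^bsub>S Quot P\<^esub> = P"
  by (simp add: FactRing_def)

lemma carrier_FactRing: "carrier (S Quot P) = (+>\<^bsub>S\<^esub>) P ` carrier S"
  by (auto simp: FactRing_def A_RCOSETS_def')

text \<open>The criterion \<open>G_domain_iff\<close> for \<open>S Quot P\<close>, pulled back to
  representatives. For prime \<open>P\<close> it says that inverting the class of \<open>s\<close>
  turns S/P into its quotient field.\<close>

definition G_witness :: "('a, 'b) ring_scheme \<Rightarrow> 'a set \<Rightarrow> 'a \<Rightarrow> bool" where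
  "G_witness S P s \<longleftrightarrow> s \<in> carrier S - P \<and> (\<forall>d\<in>carrier S - P.
     \<exists>n::nat. \<exists>e\<in>carrier S. d \<otimes>\<^bsub>S\<^esub> e \<ominus>\<^bsub>S\<^esub> s [^]\<^bsub>S\<^esub> n \<in> P)"

lemma G_witnessD:
  assumes "G_witness S P s" "d \<in> carrier S" "d \<notin> P"
  obtains n :: nat and e where "e \<in> carrier S" "d \<otimes>\<^bsub>S\<^esub> e \<ominus>\<^bsub>S\<^esub> s [^]\<^bsub>S\<^esub> n \<in> P"
  using assms unfolding G_witness_def by blast

lemma G_ideal_iff:
  fixes S (structure)
  assumes "primeideal P S"
  shows "G_ideal P S \<longleftrightarrow> (\<exists>s. G_witness S P s)"
proof -
  interpret primeideal P S by fact
  interpret Q: "domain" "S Quot P" by (rule quotient_is_domain)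
  interpret h: ring_hom_cring S "S Quot P" "(+>) P" by (rule rcos_ring_hom_cring)
  have car: "carrier (S Quot P) = (+>) P ` carrier S"
    by (rule carrier_FactRing)
  have z: "\<zero>\<^bsub>S Quot P\<^esub> = P" by (rule zero_FactRing)
  have zero: "P +> x = \<zero>\<^bsub>S Quot P\<^esub> \<longleftrightarrow> x \<in> P" if "x \<in> carrier S" for x
    unfolding z using rcos_const_imp_mem[OF that] a_rcos_zero[OF is_ideal] by blast
  have car': "carrier (S Quot P) - {\<zero>\<^bsub>S Quot P\<^esub>} = (+>) P ` (carrier S - P)"
    unfolding car using zero by auto
  have eq: "(P +> d) \<otimes>\<^bsub>S Quot P\<^esub> (P +> e) = (P +> s) [^]\<^bsub>S Quot P\<^esub> n \<longleftrightarrow> d \<otimes> e \<ominus> s [^] n \<in> P"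
    if "d \<in> carrier S" "e \<in> carrier S" "s \<in> carrier S" for d e s and n :: nat
    using that quotient_eq_iff_same_a_r_cos[OF is_ideal, of "d \<otimes> e" "s [^] n"]
    by (simp flip: h.hom_mult h.hom_pow)
  have "G_ideal P S \<longleftrightarrow> (\<exists>s\<in>carrier S - P. \<forall>d\<in>carrier S - P.
     \<exists>n::nat. \<exists>e\<in>carrier S. (P +> d) \<otimes>\<^bsub>S Quot P\<^esub> (P +> e) = (P +> s) [^]\<^bsub>S Quot P\<^esub> n)"
    unfolding G_ideal_def Q.G_domain_iff car' unfolding car
    by (simp only: assms simp_thms bex_simps ball_simps)
  also have "\<dots> \<longleftrightarrow> (\<exists>s\<in>carrier S - P. \<forall>d\<in>carrier S - P.
     \<exists>n::nat. \<exists>e\<in>carrier S. d \<otimes> e \<ominus> s [^] n \<in> P)"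
    by (intro bex_cong ball_cong ex_cong1 refl eq) auto
  finally show ?thesis unfolding G_witness_def by blast
qed


section \<open>Powers of ideals and comaximality\<close>

lemma ideal_pow_Suc:
  "I [^]\<^bsub>ideals_set R\<^esub> Suc n = ideal_prod R (I [^]\<^bsub>ideals_set R\<^esub> n) I"
  by (simp add: nat_pow_def ideals_set_def)

lemma ideal_pow_0: "I [^]\<^bsub>ideals_set R\<^esub> (0::nat) = carrier R"
  by (simp add: nat_pow_def ideals_set_def)

lemma ideal_prod_subsetI:
  assumes "\<And>i j. i \<in> I \<Longrightarrow> j \<in> J \<Longrightarrow> i \<otimes>\<^bsub>R\<^esub> j \<in> K"
    and "\<And>x y. x \<in> K \<Longrightarrow> y \<in> K \<Longrightarrow> x \<oplus>\<^bsub>R\<^esub> y \<in> K"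
  shows "ideal_prod R I J \<subseteq> K"
proof
  fix x assume "x \<in> ideal_prod R I J"
  thus "x \<in> K" by induction (use assms in auto)
qed

lemma ideal_prod_mono: "I \<subseteq> I' \<Longrightarrow> J \<subseteq> J' \<Longrightarrow> ideal_prod R I J \<subseteq> ideal_prod R I' J'"
  by (rule ideal_prod_subsetI) (auto intro: ideal_prod.intros)

lemma ideal_pow_mono: "I \<subseteq> J \<Longrightarrow> I [^]\<^bsub>ideals_set R\<^esub> (n::nat) \<subseteq> J [^]\<^bsub>ideals_set R\<^esub> n"
  by (induction n) (simp_all only: ideal_pow_0 ideal_pow_Suc ideal_prod_mono order_refl)

context cring
begin

lemma ideal_pow_is_ideal:
  assumes "ideal I R"
  shows "ideal (I [^]\<^bsub>ideals_set R\<^esub> (n::nat)) R"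
  by (induction n) (simp_all only: ideal_pow_0 ideal_pow_Suc oneideal ideal_prod_is_ideal assms)

lemma ideal_prod_pow:
  assumes "ideal I R" "ideal J R"
  shows "(I \<cdot> J) [^]\<^bsub>ideals_set R\<^esub> (n::nat)
    = (I [^]\<^bsub>ideals_set R\<^esub> n) \<cdot> (J [^]\<^bsub>ideals_set R\<^esub> n)"
proof -
  interpret M: comm_monoid "ideals_set R" by (rule ideals_set_is_comm_monoid)
  show ?thesis using M.nat_pow_distrib[of I J n] assms by (simp add: ideals_set_def)
qed

section \<open>Comaximal ideals\<close>

lemma set_add_eq_carrier_iff:
  assumes "ideal I R" "ideal J R"
  shows "I <+> J = carrier R \<longleftrightarrow> (\<exists>u\<in>I. \<exists>v\<in>J. u \<oplus> v = \<one>)"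
proof -
  have "I <+> J = carrier R \<longleftrightarrow> \<one> \<in> I <+> J"
    using ideal.one_imp_carrier[OF add_ideals[OF assms]] by auto
  also have "\<dots> \<longleftrightarrow> (\<exists>u\<in>I. \<exists>v\<in>J. u \<oplus> v = \<one>)"
    unfolding set_add_def' by (auto dest: sym)
  finally show ?thesis .
qed

text \<open>Expand 1 = (u + v)(u' + v'): every term except \<open>v \<otimes> v'\<close> contains a
  factor from \<open>I\<close>.\<close>

lemma comaximal_ideal_prod:
  assumes I: "ideal I R" "ideal J R" "ideal K R"
    and "I <+> J = carrier R" "I <+> K = carrier R"
  shows "I <+> J \<cdot> K = carrier R"
proof -
  obtain u v where uv: "u \<in> I" "v \<in> J" "u \<oplus> v = \<one>"
    using assms set_add_eq_carrier_iff by blast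
  obtain u' v' where uv': "u' \<in> I" "v' \<in> K" "u' \<oplus> v' = \<one>"
    using assms set_add_eq_carrier_iff by blast
  have car: "u \<in> carrier R" "v \<in> carrier R" "u' \<in> carrier R" "v' \<in> carrier R"
    using uv uv' I ideal.Icarr by metis+
  have "(u \<otimes> (u' \<oplus> v') \<oplus> v \<otimes> u') \<oplus> v \<otimes> v' = (u \<oplus> v) \<otimes> (u' \<oplus> v')"
    using car by (simp add: l_distr r_distr a_ac)
  also have "\<dots> = \<one>" by (simp add: uv uv')
  finally have "(u \<otimes> (u' \<oplus> v') \<oplus> v \<otimes> u') \<oplus> v \<otimes> v' = \<one>" .
  moreover have "u \<otimes> (u' \<oplus> v') \<oplus> v \<otimes> u' \<in> I"
    using ideal.I_r_closed[OF I(1) uv(1), of "u' \<oplus> v'"] ideal.I_l_closed[OF I(1) uv'(1) car(2)] car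
    by (simp add: additive_subgroup.a_closed ideal.axioms(1)[OF I(1)])
  moreover have "v \<otimes> v' \<in> J \<cdot> K"
    using uv uv' by (auto intro: ideal_prod.prod)
  ultimately show ?thesis
    using set_add_eq_carrier_iff[OF I(1) ideal_prod_is_ideal[OF I(2,3)]] by blast
qed

lemma comaximal_ideal_pow:
  assumes "ideal I R" "ideal J R" "I <+> J = carrier R"
  shows "I <+> J [^]\<^bsub>ideals_set R\<^esub> (n::nat) = carrier R"
proof (induction n)
  case 0
  have "\<zero> \<in> I" using assms(1) by (simp add: additive_subgroup.zero_closed ideal.axioms(1))
  thus ?case unfolding ideal_pow_0
    using set_add_eq_carrier_iff[OF assms(1) oneideal] l_one l_zero one_closed by blast
next
  case (Suc n)
  thus ?case
    unfolding ideal_pow_Suc using assms ideal_pow_is_ideal comaximal_ideal_prod by blast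
qed

text \<open>\<open>Q\<close> is comaximal with each member, hence with products, which lie in the
  intersection. That the intersection is an ideal is proved along, as the induction step needs it;
  the factor \<open>carrier R\<close> gives the empty family the unit ideal as its
  intersection.\<close>

lemma comaximal_Inter_maximalideals:
  assumes "finite M" "\<forall>P\<in>M. maximalideal P R" "maximalideal Q R" "Q \<notin> M"
  shows "ideal (carrier R \<inter> \<Inter>M) R \<and> Q <+> (carrier R \<inter> \<Inter>M) = carrier R"
  using assms
proof (induction M rule: finite_induct)
  case empty
  have Q: "ideal Q R" using empty by (simp add: maximalideal.axioms(1))
  hence "\<zero> \<in> Q" by (simp add: additive_subgroup.zero_closed ideal.axioms(1))
  thus ?case
    using set_add_eq_carrier_iff[OF Q oneideal] oneideal l_zero one_closed
    by (simp only: Inter_empty Int_UNIV_right) blast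
next
  case (insert P M)
  let ?B = "carrier R \<inter> \<Inter>M"
  have B: "ideal ?B R" "Q <+> ?B = carrier R" using insert by auto
  have P: "maximalideal P R" and Q: "maximalideal Q R" using insert.prems by auto
  have P': "ideal P R" and Q': "ideal Q R" using P Q by (simp_all add: maximalideal.axioms(1))
  have eq: "carrier R \<inter> \<Inter>(insert P M) = P \<inter> ?B"
    using ideal.Icarr[OF P'] by auto
  have PB: "ideal (P \<inter> ?B) R" by (rule i_intersect[OF P' B(1)])
  have sub: "Q \<subseteq> Q <+> P" "P \<subseteq> Q <+> P"
  proof -
    have "Q \<union> P \<subseteq> carrier R" using ideal.Icarr[OF Q'] ideal.Icarr[OF P'] by blast
    from genideal_self[OF this] show "Q \<subseteq> Q <+> P" "P \<subseteq> Q <+> P"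
      unfolding union_genideal[OF Q' P'] by simp_all
  qed
  have id: "ideal (Q <+> P) R" by (rule add_ideals[OF Q' P'])
  \<comment> \<open>The sum contains two distinct maximal ideals, which a proper ideal cannot
    do.\<close>
  have "Q <+> P = carrier R"
  proof (rule ccontr)
    assume "Q <+> P \<noteq> carrier R"
    moreover have "Q <+> P \<subseteq> carrier R" using ideal.Icarr[OF id] by blast
    ultimately have "Q <+> P = Q" "Q <+> P = P"
      using maximalideal.I_maximal[OF Q id sub(1)] maximalideal.I_maximal[OF P id sub(2)] by simp_all
    thus False using insert.prems by auto
  qed
  hence "Q <+> P \<cdot> ?B = carrier R"
    using comaximal_ideal_prod[OF Q' P' B(1)] B(2) by blast
  moreover have "P \<cdot> ?B \<subseteq> P \<inter> ?B" by (rule ideal_prod_inter[OF P' B(1)])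
  ultimately have "Q <+> (P \<inter> ?B) = carrier R"
    using set_add_eq_carrier_iff[OF Q' PB]
      set_add_eq_carrier_iff[OF Q' ideal_prod_is_ideal[OF P' B(1)]] by blast
  thus ?case using PB unfolding eq by blast
qed

text \<open>Powers of comaximal ideals are comaximal, so \<open>?Pt \<inter> ?Bt\<close> is the
  product of the two, that is, the power of \<open>P \<cdot> ?B\<close>.\<close>

lemma Inter_maximalideal_pow_subset:
  fixes t :: nat
  assumes "finite M" "\<forall>P\<in>M. maximalideal P R"
  shows "carrier R \<inter> (\<Inter>P\<in>M. P [^]\<^bsub>ideals_set R\<^esub> t)
    \<subseteq> (carrier R \<inter> \<Inter>M) [^]\<^bsub>ideals_set R\<^esub> t"
  using assms
proof (induction M rule: finite_induct)
  case empty
  have "\<one>\<^bsub>ideals_set R\<^esub> = carrier R" by (simp add: ideals_set_def)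
  hence "carrier R [^]\<^bsub>ideals_set R\<^esub> t = carrier R"
    using monoid.nat_pow_one[OF comm_monoid.axioms(1)[OF ideals_set_is_comm_monoid]] by metis
  thus ?case by simp
next
  case (insert P M)
  let ?B = "carrier R \<inter> \<Inter>M"
  have P: "maximalideal P R" using insert.prems by auto
  have P': "ideal P R" using P by (simp add: maximalideal.axioms(1))
  have B: "ideal ?B R" "P <+> ?B = carrier R"
    using comaximal_Inter_maximalideals[of M P] insert P by auto
  have eq: "carrier R \<inter> \<Inter>(insert P M) = P \<inter> ?B"
    using ideal.Icarr[OF P'] by auto
  let ?Pt = "P [^]\<^bsub>ideals_set R\<^esub> t" and ?Bt = "?B [^]\<^bsub>ideals_set R\<^esub> t"
  have Pt: "ideal ?Pt R" and Bt: "ideal ?Bt R"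
    using ideal_pow_is_ideal P' B(1) by blast+
  have "P <+> ?Bt = carrier R" by (rule comaximal_ideal_pow[OF P' B])
  \<comment> \<open>\<open>comaximal_ideal_pow\<close> raises only the right summand, so the
    summands are swapped to reach \<open>?Pt\<close>.\<close>
  hence "?Bt <+> P = carrier R"
    using set_add_comm[of P ?Bt] ideal.Icarr[OF P'] ideal.Icarr[OF Bt] by blast
  hence "?Bt <+> ?Pt = carrier R" by (rule comaximal_ideal_pow[OF Bt P'])
  hence "?Pt <+> ?Bt = carrier R"
    using set_add_comm[of ?Pt ?Bt] ideal.Icarr[OF Pt] ideal.Icarr[OF Bt] by blast
  hence "?Pt \<inter> ?Bt = ?Pt \<cdot> ?Bt" using ideal_prod_eq_inter[OF Pt Bt] by simp
  also have "\<dots> = (P \<cdot> ?B) [^]\<^bsub>ideals_set R\<^esub> t" by (rule ideal_prod_pow[OF P' B(1), symmetric])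
  also have "\<dots> \<subseteq> (P \<inter> ?B) [^]\<^bsub>ideals_set R\<^esub> t"
    by (rule ideal_pow_mono) (rule ideal_prod_inter[OF P' B(1)])
  finally have "?Pt \<inter> ?Bt \<subseteq> (P \<inter> ?B) [^]\<^bsub>ideals_set R\<^esub> t" .
  moreover have "carrier R \<inter> (\<Inter>P\<in>M. P [^]\<^bsub>ideals_set R\<^esub> t) \<subseteq> ?Bt" using insert by simp
  ultimately show ?case unfolding eq by auto
qed

end


section \<open>Powers of ideals of a polynomial ring\<close>

text \<open>An infinite \<open>A\<close> is covered by the convention that \<open>finsum\<close> is
  then zero.\<close>

lemma (in ideal) finsum_mem:
  "(\<And>i. i \<in> A \<Longrightarrow> f i \<in> I) \<Longrightarrow> finsum R f A \<in> I"
proof (induction A rule: infinite_finite_induct)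
  case (insert x A)
  thus ?case using Icarr by (subst finsum_insert) (auto simp: Pi_iff)
qed auto

lemma (in ideal) a_minus_mem: "a \<in> I \<Longrightarrow> b \<in> I \<Longrightarrow> a \<ominus> b \<in> I"
  by (simp add: a_minus_def)


text \<open>The extended ideal J R[X], described by coefficients instead of by generators.\<close>

definition (in UP) poly_ext :: "'a set \<Rightarrow> (nat \<Rightarrow> 'a) set"
  where "poly_ext J = {g \<in> carrier P. \<forall>n. coeff P g n \<in> J}"

lemma (in UP) contraction_eq: "contraction R Q = {r \<in> carrier R. monom P r 0 \<in> Q}"
  unfolding contraction_def P_def ..

lemma (in UP) mem_contraction_iff:
  "r \<in> carrier R \<Longrightarrow> r \<in> contraction R Q \<longleftrightarrow> monom P r 0 \<in> Q"
  by (simp add: contraction_eq)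

context UP_cring
begin

lemma poly_ext_closed [dest]: "g \<in> poly_ext J \<Longrightarrow> g \<in> carrier P"
  by (simp add: poly_ext_def)

lemma coeff_poly_ext: "g \<in> poly_ext J \<Longrightarrow> coeff P g n \<in> J"
  by (simp add: poly_ext_def)

lemma poly_ext_add:
  assumes "ideal J R" "g \<in> poly_ext J" "h \<in> poly_ext J"
  shows "g \<oplus>\<^bsub>P\<^esub> h \<in> poly_ext J"
  using assms by (auto simp: poly_ext_def additive_subgroup.a_closed ideal.axioms(1))

lemma poly_ext_mult:
  assumes J: "ideal J R" and K: "ideal K R" and gh: "g \<in> poly_ext J" "h \<in> poly_ext K"
  shows "g \<otimes>\<^bsub>P\<^esub> h \<in> poly_ext (ideal_prod R J K)"
proof -
  interpret JK: ideal "ideal_prod R J K" R by (rule R.ideal_prod_is_ideal[OF J K])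
  show ?thesis
    using gh by (auto simp: poly_ext_def intro!: JK.finsum_mem ideal_prod.prod)
qed

lemma poly_ext_mult_carrier:
  assumes "ideal J R" "g \<in> poly_ext J" "h \<in> carrier P"
  shows "g \<otimes>\<^bsub>P\<^esub> h \<in> poly_ext J" "h \<otimes>\<^bsub>P\<^esub> g \<in> poly_ext J"
proof -
  have "h \<in> poly_ext (carrier R)" using assms(3) by (simp add: poly_ext_def)
  thus "g \<otimes>\<^bsub>P\<^esub> h \<in> poly_ext J"
    using poly_ext_mult[OF assms(1) R.oneideal assms(2)] R.ideal_prod_one[OF assms(1)] by simp
  thus "h \<otimes>\<^bsub>P\<^esub> g \<in> poly_ext J" using assms UP_m_comm[of g h] by auto
qed

lemma monom_poly_ext: "ideal J R \<Longrightarrow> r \<in> J \<Longrightarrow> monom P r n \<in> poly_ext J"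
  by (auto simp: poly_ext_def ideal.Icarr additive_subgroup.zero_closed ideal.axioms(1))

lemma monom_0_mult_coeff:
  assumes "a \<in> carrier R" "g \<in> carrier P"
  shows "coeff P (monom P a 0 \<otimes>\<^bsub>P\<^esub> g) n = a \<otimes> coeff P g n"
  using assms by (simp add: monom_mult_is_smult del: coeff_mult)

lemma ideal_contraction:
  assumes "ideal Q P"
  shows "ideal (contraction R Q) R"
proof -
  interpret h: ring_hom_ring R P "\<lambda>a. monom P a 0"
    by (intro ring_hom_ringI2 R.ring_axioms UP_ring const_ring_hom)
  show ?thesis unfolding contraction_eq by (rule h.ideal_vimage[OF assms])
qed

lemma poly_ext_contraction_subset:
  assumes Q: "ideal Q P"
  shows "poly_ext (contraction R Q) \<subseteq> Q"
proof
  fix g assume g: "g \<in> poly_ext (contraction R Q)"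
  hence gc: "g \<in> carrier P" by auto
  have "monom P (coeff P g i) i \<in> Q" for i
  proof -
    have c: "coeff P g i \<in> carrier R" and q: "monom P (coeff P g i) 0 \<in> Q"
      using coeff_poly_ext[OF g] by (auto simp: contraction_eq)
    have "monom P (coeff P g i) i = monom P (coeff P g i) 0 \<otimes>\<^bsub>P\<^esub> monom P \<one> i"
      using monom_mult[of "coeff P g i" \<one> 0 i] c by simp
    thus ?thesis using ideal.I_r_closed[OF Q q] by simp
  qed
  hence "(\<Oplus>\<^bsub>P\<^esub> i \<in> {..deg R g}. monom P (coeff P g i) i) \<in> Q"
    by (intro ideal.finsum_mem[OF Q])
  thus "g \<in> Q" using up_repr[OF gc] by simp
qed

lemma contraction_prod_subset:
  assumes "ideal A P" "ideal B P"
  shows "ideal_prod R (contraction R A) (contraction R B) \<subseteq> contraction R (ideal_prod P A B)"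
proof (rule ideal_prod_subsetI)
  fix i j assume "i \<in> contraction R A" "j \<in> contraction R B"
  thus "i \<otimes> j \<in> contraction R (ideal_prod P A B)"
    using monom_mult[of i j 0 0] by (auto simp: contraction_eq intro: ideal_prod.prod)
next
  fix x y assume "x \<in> contraction R (ideal_prod P A B)" "y \<in> contraction R (ideal_prod P A B)"
  thus "x \<oplus> y \<in> contraction R (ideal_prod P A B)"
    by (rule additive_subgroup.a_closed[OF ideal.axioms(1)[OF ideal_contraction[OF
      P.ideal_prod_is_ideal[OF assms]]]])
qed

text \<open>The half of power stability that holds for every ideal of R[X]; all further work
  concerns the other inclusion.\<close>

lemma contraction_pow_subset:
  assumes "ideal Q P"
  shows "contraction R Q [^]\<^bsub>ideals_set R\<^esub> (t::nat) \<subseteq> contraction R (Q [^]\<^bsub>ideals_set P\<^esub> t)"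
proof (induction t)
  case 0
  show ?case unfolding ideal_pow_0 by (auto simp: contraction_eq)
next
  case (Suc t)
  have "contraction R Q [^]\<^bsub>ideals_set R\<^esub> Suc t
      \<subseteq> ideal_prod R (contraction R (Q [^]\<^bsub>ideals_set P\<^esub> t)) (contraction R Q)"
    unfolding ideal_pow_Suc by (rule ideal_prod_mono[OF Suc order_refl])
  also have "\<dots> \<subseteq> contraction R (Q [^]\<^bsub>ideals_set P\<^esub> Suc t)"
    unfolding ideal_pow_Suc
    by (rule contraction_prod_subset[OF P.ideal_pow_is_ideal[OF assms] assms])
  finally show ?case .
qed

section \<open>Leading coefficients modulo an ideal\<close>

lemma coeff_mult_above:
  assumes "ideal J R" "f \<in> carrier P" "g \<in> carrier P"
    and "\<And>j. m < j \<Longrightarrow> coeff P f j \<in> J" "\<And>j. n < j \<Longrightarrow> coeff P g j \<in> J" "m + n < k"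
  shows "coeff P (f \<otimes>\<^bsub>P\<^esub> g) k \<in> J"
proof -
  have "coeff P f i \<otimes> coeff P g (k - i) \<in> J" for i
  proof (cases "m < i")
    case True
    thus ?thesis using assms by (intro ideal.I_r_closed[OF assms(1)]) auto
  next
    case False
    hence "n < k - i" using assms(6) by simp
    thus ?thesis using assms by (intro ideal.I_l_closed[OF assms(1)]) auto
  qed
  thus ?thesis
    unfolding coeff_mult[OF assms(2,3)] by (intro ideal.finsum_mem[OF assms(1)])
qed

text \<open>\<open>m\<close> and \<open>n\<close> bound the degrees modulo \<open>J\<close>. In the
  convolution sum for degree \<open>m + n\<close> every index other than \<open>m\<close> pushes one
  of the two factors above its bound, so a single term survives. This holds for any ideal, prime or
  not.\<close>

lemma coeff_mult_top:
  assumes J: "ideal J R" and fg: "f \<in> carrier P" "g \<in> carrier P"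
    and f: "\<And>j. m < j \<Longrightarrow> coeff P f j \<in> J" and g: "\<And>j. n < j \<Longrightarrow> coeff P g j \<in> J"
  shows "coeff P (f \<otimes>\<^bsub>P\<^esub> g) (m + n) \<ominus> coeff P f m \<otimes> coeff P g n \<in> J"
proof -
  let ?t = "\<lambda>i. coeff P f i \<otimes> coeff P g (m + n - i)"
  have "?t i \<in> J" if "i \<in> {..m + n} - {m}" for i
  proof (cases "m < i")
    case True
    thus ?thesis using f fg by (intro ideal.I_r_closed[OF J]) auto
  next
    case False
    hence "n < m + n - i" using that by auto
    thus ?thesis using g fg by (intro ideal.I_l_closed[OF J]) auto
  qed
  hence S: "finsum R ?t ({..m + n} - {m}) \<in> J" by (rule ideal.finsum_mem[OF J])
  have "{..m + n} = insert m ({..m + n} - {m})" by auto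
  hence "finsum R ?t {..m + n} = finsum R ?t (insert m ({..m + n} - {m}))" by simp
  also have "\<dots> = ?t m \<oplus> finsum R ?t ({..m + n} - {m})"
    using fg by (intro R.finsum_insert) auto
  finally have "coeff P (f \<otimes>\<^bsub>P\<^esub> g) (m + n)
      = coeff P f m \<otimes> coeff P g n \<oplus> finsum R ?t ({..m + n} - {m})"
    using fg by simp
  moreover have "(x \<oplus> y) \<ominus> x = y" if "x \<in> carrier R" "y \<in> carrier R" for x y
    using that by (simp add: a_minus_def R.a_comm[of x y] R.a_assoc R.r_neg)
  ultimately show ?thesis using S ideal.Icarr[OF J S] fg by simp
qed

text \<open>The bound on the higher coefficients is proved together with the first claim because
  \<open>coeff_mult_top\<close> needs it for the next factor.\<close>

lemma coeff_pow_top: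
  assumes J: "ideal J R" and f: "f \<in> carrier P" "\<And>j. m < j \<Longrightarrow> coeff P f j \<in> J"
  shows "coeff P (f [^]\<^bsub>P\<^esub> (n::nat)) (m * n) \<ominus> coeff P f m [^] n \<in> J
    \<and> (\<forall>j > m * n. coeff P (f [^]\<^bsub>P\<^esub> n) j \<in> J)"
proof (induction n)
  case 0
  have "\<zero> \<in> J" using J by (simp add: additive_subgroup.zero_closed ideal.axioms(1))
  thus ?case by (simp add: a_minus_def R.r_neg)
next
  case (Suc n)
  let ?g = "f [^]\<^bsub>P\<^esub> n"
  have g: "?g \<in> carrier P" using f by simp
  have 1: "coeff P (?g \<otimes>\<^bsub>P\<^esub> f) (m * n + m) \<ominus> coeff P ?g (m * n) \<otimes> coeff P f m \<in> J" (is "?a \<ominus> ?b \<in> J")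
    using Suc f g by (intro coeff_mult_top[OF J]) auto
  have "(coeff P ?g (m * n) \<ominus> coeff P f m [^] n) \<otimes> coeff P f m \<in> J" (is "?c \<in> J")
    using Suc f by (intro ideal.I_r_closed[OF J]) auto
  hence "(?a \<ominus> ?b) \<oplus> ?c \<in> J" using 1 J by (simp add: additive_subgroup.a_closed ideal.axioms(1))
  moreover have "?c = ?b \<ominus> coeff P f m [^] Suc n"
    using f g by (simp add: a_minus_def R.l_distr R.l_minus)
  moreover have "(x \<ominus> y) \<oplus> (y \<ominus> z) = x \<ominus> z"
    if "x \<in> carrier R" "y \<in> carrier R" "z \<in> carrier R" for x y z
    using that by (simp add: a_minus_def R.a_assoc R.r_neg1 R.r_neg2)
  ultimately have "?a \<ominus> coeff P f m [^] Suc n \<in> J" using f g by (simp del: coeff_mult)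
  moreover have "\<forall>j > m * n + m. coeff P (?g \<otimes>\<^bsub>P\<^esub> f) j \<in> J"
    using Suc f g by (blast intro: coeff_mult_above[OF J])
  ultimately show ?case by (simp add: add.commute del: coeff_mult)
qed

lemma const_mem_poly_ext_add_monic:
  assumes J: "ideal J R" and f: "f \<in> carrier P"
    and monic: "f = \<zero>\<^bsub>P\<^esub> \<or> (coeff P f m = \<one> \<and> m > 0 \<and> (\<forall>j>m. coeff P f j = \<zero>))"
    and p: "p \<in> poly_ext J" and q: "q \<in> carrier P"
    and r: "r \<in> carrier R" "monom P r 0 = p \<oplus>\<^bsub>P\<^esub> f \<otimes>\<^bsub>P\<^esub> q"
  shows "r \<in> J"
proof -
  interpret J: ideal J R by fact
  have pc: "p \<in> carrier P" using p by auto
  have fq: "f \<otimes>\<^bsub>P\<^esub> q \<in> carrier P" using f q by simp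
  have co: "coeff P (monom P r 0) i = coeff P p i \<oplus> coeff P (f \<otimes>\<^bsub>P\<^esub> q) i" for i
    unfolding r(2) using pc fq by (simp del: coeff_mult)
  have "f \<otimes>\<^bsub>P\<^esub> q \<in> poly_ext J"
  proof (cases "f = \<zero>\<^bsub>P\<^esub>")
    case True
    thus ?thesis using q by (simp add: poly_ext_def)
  next
    case False
    with monic have m: "coeff P f m = \<one>" "m > 0" "\<And>j. j > m \<Longrightarrow> coeff P f j = \<zero>" by auto
    \<comment> \<open>Otherwise the last coefficient of \<open>q\<close> outside \<open>J\<close> reappears modulo \<open>J\<close> in \<open>p + f q\<close>, in
      degree at least \<open>m > 0\<close>.\<close>
    have "q \<in> poly_ext J"
    proof (rule ccontr)
      assume "q \<notin> poly_ext J"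
      let ?N = "{i. coeff P q i \<notin> J}"
      have ne: "?N \<noteq> {}" using \<open>q \<notin> poly_ext J\<close> q by (auto simp: poly_ext_def)
      have "?N \<subseteq> {..deg R q}"
        using deg_aboveD[OF _ q] by (force simp: not_le[symmetric])
      hence fin: "finite ?N" by (rule finite_subset) simp
      define i where "i = Max ?N"
      have i: "coeff P q i \<notin> J" using Max_in[OF fin ne] by (simp add: i_def)
      have above: "coeff P q j \<in> J" if "j > i" for j
        using Max_ge[OF fin, of j] that by (auto simp: i_def)
      let ?c = "coeff P (f \<otimes>\<^bsub>P\<^esub> q) (m + i)"
      have c: "?c \<in> carrier R" using coeff_closed[OF fq] .
      have "?c \<ominus> coeff P f m \<otimes> coeff P q i \<in> J"
      proof (rule coeff_mult_top[OF J f q])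
        show "coeff P f j \<in> J" if "m < j" for j using m(3)[OF that] by simp
      qed (rule above)
      hence 1: "?c \<ominus> coeff P q i \<in> J" unfolding m(1) using q by (simp del: coeff_mult)
      have "coeff P (monom P r 0) (m + i) = \<zero>" using r(1) m(2) by simp
      hence "?c \<oplus> coeff P p (m + i) = \<zero>"
        using co[of "m + i"] c pc by (simp add: R.a_comm del: coeff_mult)
      hence "?c = \<ominus> coeff P p (m + i)"
        using c pc by (intro R.sum_zero_eq_neg) auto
      hence 2: "?c \<in> J" using coeff_poly_ext[OF p] by simp
      have "?c \<ominus> (?c \<ominus> coeff P q i) \<in> J" by (rule J.a_minus_mem[OF 2 1])
      moreover have "x \<ominus> (x \<ominus> y) = y" if "x \<in> carrier R" "y \<in> carrier R" for x y
        using that by (simp add: a_minus_def R.minus_add R.r_neg2)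
      ultimately show False using i c q by (simp del: coeff_mult)
    qed
    thus ?thesis using poly_ext_mult_carrier[OF J _ f] by blast
  qed
  hence "coeff P p 0 \<oplus> coeff P (f \<otimes>\<^bsub>P\<^esub> q) 0 \<in> J"
    using coeff_poly_ext[OF p] coeff_poly_ext by (intro J.a_closed)
  thus ?thesis using co[of 0] r(1) by (simp del: coeff_mult)
qed

text \<open>In the product (p + f q)(p' + f q') only p p' is free of the factor \<open>f\<close>, so
  only this part has to be tracked through the powers of \<open>J\<close>.\<close>

lemma ideal_pow_subset_poly_ext_add:
  assumes J: "ideal J R" and Q: "ideal Q P" and f: "f \<in> carrier P"
    and sub: "\<And>g. g \<in> Q \<Longrightarrow> \<exists>p\<in>poly_ext J. \<exists>q\<in>carrier P. g = p \<oplus>\<^bsub>P\<^esub> f \<otimes>\<^bsub>P\<^esub> q"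
    and "g \<in> Q [^]\<^bsub>ideals_set P\<^esub> (t::nat)"
  shows "\<exists>p\<in>poly_ext (J [^]\<^bsub>ideals_set R\<^esub> t). \<exists>q\<in>carrier P. g = p \<oplus>\<^bsub>P\<^esub> f \<otimes>\<^bsub>P\<^esub> q"
  using assms(5)
proof (induction t arbitrary: g)
  case 0
  hence "g \<in> carrier P" by (simp only: ideal_pow_0)
  moreover from this have "g \<in> poly_ext (carrier R)" by (simp add: poly_ext_def)
  ultimately show ?case unfolding ideal_pow_0 using f by (intro bexI[of _ g] bexI[of _ "\<zero>\<^bsub>P\<^esub>"]) auto
next
  case (Suc t)
  let ?Jt = "J [^]\<^bsub>ideals_set R\<^esub> t"
  let ?K = "{g. \<exists>p\<in>poly_ext (J [^]\<^bsub>ideals_set R\<^esub> Suc t). \<exists>q\<in>carrier P. g = p \<oplus>\<^bsub>P\<^esub> f \<otimes>\<^bsub>P\<^esub> q}"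
  have "ideal_prod P (Q [^]\<^bsub>ideals_set P\<^esub> t) Q \<subseteq> ?K"
  proof (rule ideal_prod_subsetI)
    fix i j assume ij: "i \<in> Q [^]\<^bsub>ideals_set P\<^esub> t" "j \<in> Q"
    obtain p q where pq: "p \<in> poly_ext ?Jt" "q \<in> carrier P" "i = p \<oplus>\<^bsub>P\<^esub> f \<otimes>\<^bsub>P\<^esub> q"
      using Suc.IH[OF ij(1)] by blast
    obtain p' q' where pq': "p' \<in> poly_ext J" "q' \<in> carrier P" "j = p' \<oplus>\<^bsub>P\<^esub> f \<otimes>\<^bsub>P\<^esub> q'"
      using sub[OF ij(2)] by blast
    have c: "p \<in> carrier P" "p' \<in> carrier P" using pq pq' by auto
    have "p \<otimes>\<^bsub>P\<^esub> p' \<in> poly_ext (J [^]\<^bsub>ideals_set R\<^esub> Suc t)"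
      unfolding ideal_pow_Suc by (rule poly_ext_mult[OF R.ideal_pow_is_ideal[OF J] J pq(1) pq'(1)])
    moreover have "i \<otimes>\<^bsub>P\<^esub> j
        = p \<otimes>\<^bsub>P\<^esub> p' \<oplus>\<^bsub>P\<^esub> f \<otimes>\<^bsub>P\<^esub> (p \<otimes>\<^bsub>P\<^esub> q' \<oplus>\<^bsub>P\<^esub> q \<otimes>\<^bsub>P\<^esub> (p' \<oplus>\<^bsub>P\<^esub> f \<otimes>\<^bsub>P\<^esub> q'))"
      unfolding pq(3) pq'(3) using c pq(2) pq'(2) f
      by (simp add: P.l_distr P.r_distr P.m_ac P.a_ac)
    ultimately show "i \<otimes>\<^bsub>P\<^esub> j \<in> ?K" using c pq(2) pq'(2) f by blast
  next
    fix x y assume "x \<in> ?K" "y \<in> ?K"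
    then obtain p q p' q' where pq: "p \<in> poly_ext (J [^]\<^bsub>ideals_set R\<^esub> Suc t)" "q \<in> carrier P"
      "x = p \<oplus>\<^bsub>P\<^esub> f \<otimes>\<^bsub>P\<^esub> q" "p' \<in> poly_ext (J [^]\<^bsub>ideals_set R\<^esub> Suc t)" "q' \<in> carrier P"
      "y = p' \<oplus>\<^bsub>P\<^esub> f \<otimes>\<^bsub>P\<^esub> q'" by blast
    have "p \<oplus>\<^bsub>P\<^esub> p' \<in> poly_ext (J [^]\<^bsub>ideals_set R\<^esub> Suc t)"
      by (rule poly_ext_add[OF R.ideal_pow_is_ideal[OF J] pq(1,4)])
    moreover have "p \<in> carrier P" "p' \<in> carrier P" using pq by auto
    hence "x \<oplus>\<^bsub>P\<^esub> y = (p \<oplus>\<^bsub>P\<^esub> p') \<oplus>\<^bsub>P\<^esub> f \<otimes>\<^bsub>P\<^esub> (q \<oplus>\<^bsub>P\<^esub> q')"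
      unfolding pq(3,6) using pq(2,5) f by (simp add: P.r_distr P.a_ac)
    ultimately show "x \<oplus>\<^bsub>P\<^esub> y \<in> ?K" using pq(2,5) by blast
  qed
  thus ?case using Suc.prems unfolding ideal_pow_Suc by blast
qed

lemma contraction_ideal_pow_subset:
  assumes J: "ideal J R" and Q: "ideal Q P" and f: "f \<in> carrier P"
    and monic: "f = \<zero>\<^bsub>P\<^esub> \<or> (coeff P f m = \<one> \<and> m > 0 \<and> (\<forall>j>m. coeff P f j = \<zero>))"
    and sub: "\<And>g. g \<in> Q \<Longrightarrow> \<exists>p\<in>poly_ext J. \<exists>q\<in>carrier P. g = p \<oplus>\<^bsub>P\<^esub> f \<otimes>\<^bsub>P\<^esub> q"
  shows "contraction R (Q [^]\<^bsub>ideals_set P\<^esub> (t::nat)) \<subseteq> J [^]\<^bsub>ideals_set R\<^esub> t"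
proof
  fix r assume "r \<in> contraction R (Q [^]\<^bsub>ideals_set P\<^esub> t)"
  hence r: "r \<in> carrier R" "monom P r 0 \<in> Q [^]\<^bsub>ideals_set P\<^esub> t" by (auto simp: contraction_eq)
  obtain p q where pq: "p \<in> poly_ext (J [^]\<^bsub>ideals_set R\<^esub> t)" "q \<in> carrier P"
    "monom P r 0 = p \<oplus>\<^bsub>P\<^esub> f \<otimes>\<^bsub>P\<^esub> q"
    using ideal_pow_subset_poly_ext_add[OF J Q f sub r(2)] by auto
  show "r \<in> J [^]\<^bsub>ideals_set R\<^esub> t"
    by (rule const_mem_poly_ext_add_monic[OF R.ideal_pow_is_ideal[OF J] f monic pq(1,2) r(1) pq(3)])
qed

end


section \<open>Contractions of prime ideals of a polynomial ring\<close>

text \<open>Congruences modulo \<open>I\<close> become equations in \<open>S\<close>, which can be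
  chained by rewriting in the computations with pseudo-division.\<close>

lemma (in cring) quotient_homE:
  assumes "ideal I R"
  obtains h and S :: "'a set ring" where "ring_hom_cring R S h"
    "\<And>x y. x \<in> carrier R \<Longrightarrow> y \<in> carrier R \<Longrightarrow> x \<ominus> y \<in> I \<longleftrightarrow> h x = h y"
    "\<And>x. x \<in> carrier R \<Longrightarrow> x \<in> I \<longleftrightarrow> h x = \<zero>\<^bsub>S\<^esub>"
proof (rule that)
  show hom: "ring_hom_cring R (R Quot I) ((+>) I)"
    by (rule ideal.rcos_ring_hom_cring[OF assms is_cring])
  show *: "x \<ominus> y \<in> I \<longleftrightarrow> I +> x = I +> y" if "x \<in> carrier R" "y \<in> carrier R" for x y
    by (rule quotient_eq_iff_same_a_r_cos[OF assms that])
  show "x \<in> I \<longleftrightarrow> I +> x = \<zero>\<^bsub>R Quot I\<^esub>" if "x \<in> carrier R" for x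
    using *[OF that zero_closed] that ring_hom_cring.hom_zero[OF hom] by (simp add: a_minus_def)
qed

lemma (in primeideal) pow_mem_iff: "a \<in> carrier R \<Longrightarrow> a [^] (n::nat) \<in> I \<Longrightarrow> a \<in> I"
proof (induction n)
  case 0
  thus ?case using I_notcarr one_imp_carrier by auto
next
  case (Suc n)
  thus ?case using I_prime[of "a [^] n" a] by auto
qed

text \<open>\<open>M\<close> and \<open>a\<close> together generate the whole ring; writing 1 = u +
  b a with \<open>u\<close> in \<open>M\<close> gives the inverse.\<close>

lemma (in cring) maximalideal_inverse:
  assumes "maximalideal M R" "a \<in> carrier R" "a \<notin> M"
  shows "\<exists>b\<in>carrier R. a \<otimes> b \<ominus> \<one> \<in> M"
proof -
  interpret M: maximalideal M R by fact
  have id: "ideal (M <+> PIdl a) R" by (rule add_ideals[OF M.is_ideal cgenideal_ideal[OF assms(2)]])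
  have "M \<union> PIdl a \<subseteq> carrier R"
    using M.Icarr ideal.Icarr[OF cgenideal_ideal[OF assms(2)]] by blast
  from genideal_self[OF this] have sub: "M \<subseteq> M <+> PIdl a" "PIdl a \<subseteq> M <+> PIdl a"
    unfolding union_genideal[OF M.is_ideal cgenideal_ideal[OF assms(2)]] by simp_all
  have "M <+> PIdl a \<noteq> M" using sub(2) cgenideal_self[OF assms(2)] assms(3) by blast
  moreover have "M <+> PIdl a \<subseteq> carrier R" using ideal.Icarr[OF id] by blast
  ultimately have "M <+> PIdl a = carrier R" using M.I_maximal[OF id sub(1)] by simp
  then obtain u v where uv: "u \<in> M" "v \<in> PIdl a" "u \<oplus> v = \<one>"
    using set_add_eq_carrier_iff[OF M.is_ideal cgenideal_ideal[OF assms(2)]] by blast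
  then obtain b where b: "b \<in> carrier R" "v = b \<otimes> a" by (auto simp: cgenideal_def)
  have u: "u \<in> carrier R" using uv M.Icarr by blast
  have "a \<otimes> b \<ominus> \<one> = \<ominus> u"
    unfolding uv(3)[symmetric] using u b assms(2)
    by (simp add: a_minus_def minus_add m_comm[of a b] r_neg2 a_comm[of "\<ominus> u"])
  moreover have "\<ominus> u \<in> M"
    by (rule additive_subgroup.a_inv_closed[OF ideal.axioms(1)[OF M.is_ideal] uv(1)])
  ultimately show ?thesis using b(1) by metis
qed

context UP_cring
begin

lemma primeideal_contraction:
  assumes "primeideal Q P"
  shows "primeideal (contraction R Q) R"
proof (rule primeidealI)
  interpret Q: primeideal Q P by fact
  show "ideal (contraction R Q) R" by (rule ideal_contraction[OF Q.is_ideal])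
  show "cring R" by (rule R.is_cring)
  show "carrier R \<noteq> contraction R Q"
  proof
    assume "carrier R = contraction R Q"
    hence "\<one> \<in> contraction R Q" using R.one_closed by simp
    hence "\<one>\<^bsub>P\<^esub> \<in> Q" by (simp add: contraction_eq)
    thus False using Q.one_imp_carrier Q.I_notcarr by simp
  qed
  show "a \<in> contraction R Q \<or> b \<in> contraction R Q"
    if "a \<in> carrier R" "b \<in> carrier R" "a \<otimes> b \<in> contraction R Q" for a b
    using that Q.I_prime[of "monom P a 0" "monom P b 0"] monom_mult[of a b 0 0]
    by (auto simp: contraction_eq)
qed

text \<open>Removing a leading term whose coefficient lies in \<open>J\<close> keeps the class
  modulo J[X] and lowers the degree. A constant has no room to drop, but then lies in J[X]
  itself.\<close>

lemma deg_less_of_leading_coeff_mem: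
  assumes J: "ideal J R" and g: "g \<in> carrier P" and lc: "coeff P g (deg R g) \<in> J"
  shows "g \<in> poly_ext J \<or> (\<exists>g'\<in>carrier P. g \<ominus>\<^bsub>P\<^esub> g' \<in> poly_ext J \<and> deg R g' < deg R g)"
proof (cases "deg R g = 0")
  case True
  have "g = monom P (coeff P g 0) 0" by (rule deg_zero_impl_monom[OF g True])
  thus ?thesis using monom_poly_ext[OF J] lc True by metis
next
  case False
  let ?m = "monom P (coeff P g (deg R g)) (deg R g)"
  have m: "?m \<in> poly_ext J" by (rule monom_poly_ext[OF J lc])
  hence mc: "?m \<in> carrier P" by auto
  have "deg R (g \<ominus>\<^bsub>P\<^esub> ?m) \<le> deg R g - 1"
  proof (rule deg_aboveI)
    fix k assume "deg R g - 1 < k"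
    hence "k = deg R g \<or> deg R g < k" by auto
    thus "coeff P (g \<ominus>\<^bsub>P\<^esub> ?m) k = \<zero>"
      using g deg_aboveD[OF _ g] by (auto simp: a_minus_def R.r_neg)
  qed (use g mc in simp)
  moreover have "g \<ominus>\<^bsub>P\<^esub> (g \<ominus>\<^bsub>P\<^esub> ?m) = ?m"
    using g mc by (simp add: a_minus_def P.minus_add P.r_neg2)
  ultimately show ?thesis using False g m mc by (intro disjI2 bexI[of _ "g \<ominus>\<^bsub>P\<^esub> ?m"]) auto
qed

text \<open>If the leading coefficient of a minimal \<open>f\<close> were in the contraction M,
  removing the leading term would give a smaller element of \<open>Q\<close> outside M[X]. A
  constant in \<open>Q\<close> has its value in M by definition, hence the positive degree.\<close>

lemma min_degE:
  assumes Q: "primeideal Q P" and ne: "\<not> Q \<subseteq> poly_ext (contraction R Q)"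
  obtains f where "f \<in> Q" "coeff P f (deg R f) \<notin> contraction R Q" "deg R f > 0"
    "\<And>g. g \<in> Q \<Longrightarrow> deg R g < deg R f \<Longrightarrow> g \<in> poly_ext (contraction R Q)"
proof -
  interpret Q: primeideal Q P by fact
  let ?M = "contraction R Q"
  have M: "ideal ?M R" by (rule ideal_contraction[OF Q.is_ideal])
  have sub: "poly_ext ?M \<subseteq> Q" by (rule poly_ext_contraction_subset[OF Q.is_ideal])
  obtain f where f: "f \<in> Q - poly_ext ?M" and min: "\<And>g. g \<in> Q - poly_ext ?M \<Longrightarrow> deg R f \<le> deg R g"
    using ex_has_least_nat[of "\<lambda>g. g \<in> Q - poly_ext ?M" _ "deg R"] ne by blast
  have fc: "f \<in> carrier P" using f Q.Icarr by blast
  have lc: "coeff P f (deg R f) \<notin> ?M"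
  proof
    assume "coeff P f (deg R f) \<in> ?M"
    then obtain g where g: "g \<in> carrier P" "f \<ominus>\<^bsub>P\<^esub> g \<in> poly_ext ?M" "deg R g < deg R f"
      using deg_less_of_leading_coeff_mem[OF M fc] f by blast
    have e: "f \<ominus>\<^bsub>P\<^esub> (f \<ominus>\<^bsub>P\<^esub> g) = g" "(f \<ominus>\<^bsub>P\<^esub> g) \<oplus>\<^bsub>P\<^esub> g = f"
      using fc g by (simp_all add: a_minus_def P.minus_add P.r_neg2 P.a_assoc P.l_neg)
    have "f \<ominus>\<^bsub>P\<^esub> (f \<ominus>\<^bsub>P\<^esub> g) \<in> Q" using f g(2) sub by (auto intro!: Q.a_minus_mem[of f "f \<ominus>\<^bsub>P\<^esub> g"])
    hence "g \<in> Q" unfolding e .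
    moreover have "g \<notin> poly_ext ?M" using poly_ext_add[OF M g(2), of g] f unfolding e by blast
    ultimately show False using min[of g] g(3) by simp
  qed
  show ?thesis
  proof (rule that)
    show "f \<in> Q" using f by simp
    show "coeff P f (deg R f) \<notin> ?M" by (rule lc)
    show "deg R f > 0"
    proof (rule ccontr)
      assume "\<not> deg R f > 0"
      hence d: "deg R f = 0" by simp
      hence "f = monom P (coeff P f 0) 0" using deg_zero_impl_monom[OF fc] by simp
      hence "coeff P f 0 \<in> ?M" using f fc by (simp add: contraction_eq)
      thus False using lc d by simp
    qed
    show "g \<in> poly_ext ?M" if "g \<in> Q" "deg R g < deg R f" for g
      using min[of g] that by force
  qed
qed

text \<open>With M the contraction, R/M is a field, so the image of \<open>Q\<close> in (R/M)[X] is
  principal, generated by an element of least degree. The argument is carried out in R[X] to obtain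
  an \<open>f\<close> that is monic there.\<close>

lemma maximal_contraction_generator:
  assumes Q: "primeideal Q P" and max: "maximalideal (contraction R Q) R"
  obtains f m where "f \<in> carrier P"
    "f = \<zero>\<^bsub>P\<^esub> \<or> (coeff P f m = \<one> \<and> m > 0 \<and> (\<forall>j>m. coeff P f j = \<zero>))"
    "\<And>g. g \<in> Q \<Longrightarrow> \<exists>p\<in>poly_ext (contraction R Q). \<exists>q\<in>carrier P. g = p \<oplus>\<^bsub>P\<^esub> f \<otimes>\<^bsub>P\<^esub> q"
proof (cases "Q \<subseteq> poly_ext (contraction R Q)")
  case True
  show ?thesis
  proof (rule that[of "\<zero>\<^bsub>P\<^esub>" 0])
    fix g assume "g \<in> Q"
    hence g: "g \<in> poly_ext (contraction R Q)" using True by blast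
    hence "g \<in> carrier P" by auto
    thus "\<exists>p\<in>poly_ext (contraction R Q). \<exists>q\<in>carrier P. g = p \<oplus>\<^bsub>P\<^esub> \<zero>\<^bsub>P\<^esub> \<otimes>\<^bsub>P\<^esub> q"
      using g by (intro bexI[of _ g] bexI[of _ "\<zero>\<^bsub>P\<^esub>"]) auto
  qed auto
next
  case False
  interpret Q: primeideal Q P by fact
  let ?M = "contraction R Q"
  interpret M: maximalideal ?M R by fact
  obtain f where f: "f \<in> Q" "coeff P f (deg R f) \<notin> ?M" "deg R f > 0"
    and min: "\<And>g. g \<in> Q \<Longrightarrow> deg R g < deg R f \<Longrightarrow> g \<in> poly_ext ?M"
    using min_degE[OF Q False] by blast
  have fc: "f \<in> carrier P" using f Q.Icarr by blast
  let ?m = "deg R f"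
  define a where "a = coeff P f ?m"
  have a: "a \<in> carrier R" "a \<notin> ?M" using f fc by (simp_all add: a_def)
  obtain b where b: "b \<in> carrier R" "a \<otimes> b \<ominus> \<one> \<in> ?M"
    using R.maximalideal_inverse[OF max a] by blast
  \<comment> \<open>\<open>b\<close> inverts the leading coefficient \<open>a\<close> only modulo
    \<open>?M\<close>. Adding c X^m with c = 1 - b a in \<open>?M\<close> makes the leading
    coefficient exactly 1 without leaving \<open>Q\<close>.\<close>
  define c where "c = \<ominus> (a \<otimes> b \<ominus> \<one>)"
  have c: "c \<in> ?M" unfolding c_def using b by simp
  have cc: "c \<in> carrier R" using M.Icarr[OF c] .
  have bac: "b \<otimes> a \<oplus> c = \<one>"
    using a b unfolding c_def by (simp add: a_minus_def R.minus_add R.m_comm[of b a] R.r_neg2 R.a_assoc[symmetric] R.r_neg)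
  let ?f = "monom P b 0 \<otimes>\<^bsub>P\<^esub> f \<oplus>\<^bsub>P\<^esub> monom P c ?m"
  have co: "coeff P ?f j = b \<otimes> coeff P f j \<oplus> (if j = ?m then c else \<zero>)" for j
    using fc b cc by (auto simp: monom_0_mult_coeff simp del: coeff_mult)
  have f1: "coeff P ?f ?m = \<one>" unfolding co using bac by (simp add: a_def)
  have f0: "coeff P ?f j = \<zero>" if "j > ?m" for j
    unfolding co using that deg_aboveD[OF that fc] b(1) by simp
  have f'c: "?f \<in> carrier P" using fc b cc by simp
  have f'Q: "?f \<in> Q"
    using Q.I_l_closed[OF f(1)] b(1) monom_poly_ext[OF M.is_ideal c]
      poly_ext_contraction_subset[OF Q.is_ideal] by (intro Q.a_closed) auto
  have nz: "\<one> \<noteq> \<zero>"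
    using M.I_notcarr M.one_imp_carrier M.zero_closed by metis
  \<comment> \<open>\<open>f\<close> and \<open>?f\<close> have the same degree, so the minimality
    of \<open>f\<close> applies to remainders of division by \<open>?f\<close>.\<close>
  have deg: "deg R ?f = ?m"
  proof (rule antisym)
    show "deg R ?f \<le> ?m" by (rule deg_aboveI[OF f0 f'c])
    show "?m \<le> deg R ?f" using f1 nz by (intro deg_belowI) (simp_all add: f'c)
  qed
  have fn: "?f \<noteq> \<zero>\<^bsub>P\<^esub>" using f1 nz by (metis coeff_zero)
  show ?thesis
  proof (rule that[OF f'c])
    show "?f = \<zero>\<^bsub>P\<^esub> \<or> (coeff P ?f ?m = \<one> \<and> ?m > 0 \<and> (\<forall>j>?m. coeff P ?f j = \<zero>))"
      using f1 f0 f(3) by blast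
    fix g assume g: "g \<in> Q"
    have gc: "g \<in> carrier P" using Q.Icarr[OF g] .
    obtain q r and k :: nat where qr: "q \<in> carrier P" "r \<in> carrier P"
      "coeff P ?f (deg R ?f) [^] k \<odot>\<^bsub>P\<^esub> g = ?f \<otimes>\<^bsub>P\<^esub> q \<oplus>\<^bsub>P\<^esub> r"
      "r = \<zero>\<^bsub>P\<^esub> \<or> deg R r < deg R ?f"
      using long_div_theorem[OF f'c gc fn] by blast
    \<comment> \<open>With leading coefficient 1 the pseudo-division is a true division.\<close>
    have e: "g = ?f \<otimes>\<^bsub>P\<^esub> q \<oplus>\<^bsub>P\<^esub> r" using qr(3) gc unfolding deg f1 by simp
    have "r = g \<ominus>\<^bsub>P\<^esub> ?f \<otimes>\<^bsub>P\<^esub> q"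
    proof -
      have "(x \<oplus>\<^bsub>P\<^esub> r) \<ominus>\<^bsub>P\<^esub> x = r" if "x \<in> carrier P" for x
        using that qr(2) by (simp add: a_minus_def P.a_comm[of x r] P.a_assoc P.r_neg)
      thus ?thesis unfolding e using f'c qr(1) by simp
    qed
    hence "r \<in> Q" using g Q.I_r_closed[OF f'Q qr(1)] by (simp add: Q.a_minus_mem)
    hence "r \<in> poly_ext ?M"
      using qr(4) min[of r] poly_ext_def M.zero_closed unfolding deg by auto
    moreover have "g = r \<oplus>\<^bsub>P\<^esub> ?f \<otimes>\<^bsub>P\<^esub> q"
      unfolding e using P.a_comm[of r "?f \<otimes>\<^bsub>P\<^esub> q"] qr(1,2) f'c by simp
    ultimately show "\<exists>p\<in>poly_ext ?M. \<exists>q\<in>carrier P. g = p \<oplus>\<^bsub>P\<^esub> ?f \<otimes>\<^bsub>P\<^esub> q"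
      using qr(1) by blast
  qed
qed

text \<open>Here R[X]/Q is a polynomial ring over R/M, where M is the contraction. If a constant
  \<open>d\<close> divides s^n there, it divides every coefficient of s^n, in particular the one in
  degree \<open>i * n\<close>, which is the n-th power of the last coefficient of \<open>s\<close>
  outside M.\<close>

lemma G_witness_contraction_extended:
  assumes Q: "primeideal Q P" and sub: "Q \<subseteq> poly_ext (contraction R Q)"
    and s: "G_witness P Q s"
  shows "\<exists>s0. G_witness R (contraction R Q) s0"
proof -
  interpret Q: primeideal Q P by fact
  let ?M = "contraction R Q"
  have M: "ideal ?M R" by (rule ideal_contraction[OF Q.is_ideal])
  interpret M: ideal ?M R by fact
  have sc: "s \<in> carrier P" and sQ: "s \<notin> Q" using s by (simp_all add: G_witness_def)
  let ?N = "{i. coeff P s i \<notin> ?M}"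
  have ne: "?N \<noteq> {}"
    using sQ sc poly_ext_contraction_subset[OF Q.is_ideal] by (auto simp: poly_ext_def)
  have "?N \<subseteq> {..deg R s}"
    using deg_aboveD[OF _ sc] M.zero_closed by (force simp: not_le[symmetric])
  hence fin: "finite ?N" by (rule finite_subset) simp
  define i where "i = Max ?N"
  have i: "coeff P s i \<notin> ?M" using Max_in[OF fin ne] by (simp add: i_def)
  have above: "coeff P s j \<in> ?M" if "j > i" for j
    using Max_ge[OF fin, of j] that by (auto simp: i_def)
  let ?s = "coeff P s i"
  have "\<exists>n::nat. \<exists>e\<in>carrier R. d \<otimes> e \<ominus> ?s [^] n \<in> ?M" if d: "d \<in> carrier R - ?M" for d
  proof -
    have "monom P d 0 \<in> carrier P" "monom P d 0 \<notin> Q"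
      using d mem_contraction_iff[of d Q] monom_closed[of d 0] by blast+
    from G_witnessD[OF s this] obtain n :: nat and e
      where e: "e \<in> carrier P" "monom P d 0 \<otimes>\<^bsub>P\<^esub> e \<ominus>\<^bsub>P\<^esub> s [^]\<^bsub>P\<^esub> n \<in> Q" .
    have dc: "d \<in> carrier R" using d by simp
    let ?u = "d \<otimes> coeff P e (i * n)" and ?v = "coeff P (s [^]\<^bsub>P\<^esub> n) (i * n)" and ?w = "?s [^] n"
    have "coeff P (monom P d 0 \<otimes>\<^bsub>P\<^esub> e \<ominus>\<^bsub>P\<^esub> s [^]\<^bsub>P\<^esub> n) (i * n) \<in> ?M"
      by (rule coeff_poly_ext[OF subsetD[OF sub e(2)]])
    hence 1: "?u \<ominus> ?v \<in> ?M"
      using dc e(1) sc by (simp add: monom_0_mult_coeff del: coeff_mult)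
    have 2: "?v \<ominus> ?w \<in> ?M" by (rule conjunct1[OF coeff_pow_top[OF M sc above]])
    have "(?u \<ominus> ?v) \<oplus> (?v \<ominus> ?w) \<in> ?M" using 1 2 by (rule M.a_closed)
    moreover have "(x \<ominus> y) \<oplus> (y \<ominus> z) = x \<ominus> z"
      if "x \<in> carrier R" "y \<in> carrier R" "z \<in> carrier R" for x y z
      using that by (simp add: a_minus_def R.a_assoc R.r_neg1 R.r_neg2)
    ultimately have "?u \<ominus> ?w \<in> ?M" using dc e(1) sc by simp
    thus ?thesis using e(1) by (intro exI[of _ n] bexI[of _ "coeff P e (i * n)"]) auto
  qed
  thus ?thesis
    unfolding G_witness_def using i coeff_closed[OF sc] by (intro exI[of _ ?s]) blast
qed

end

section \<open>Descent of a witness along a prime that is not extended\<close>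

context UP_domain
begin

text \<open>With M the contraction, R[X]/Q is algebraic over R/M because \<open>Q\<close> is larger
  than M[X]; hence every nonzero ideal of R[X]/Q meets R/M nontrivially. A polynomial of least
  degree takes the place of a minimal equation for \<open>s\<close>.\<close>

lemma exists_const_mem_ideal_add:
  assumes Q: "primeideal Q P" and ne: "\<not> Q \<subseteq> poly_ext (contraction R Q)"
    and s: "s \<in> carrier P" "s \<notin> Q"
  shows "\<exists>c\<in>carrier R - contraction R Q. \<exists>h\<in>carrier P. monom P c 0 \<ominus>\<^bsub>P\<^esub> s \<otimes>\<^bsub>P\<^esub> h \<in> Q"
proof -
  interpret Q: primeideal Q P by fact
  let ?M = "contraction R Q"
  interpret M: primeideal ?M R by (rule primeideal_contraction[OF Q])
  obtain S :: "(nat \<Rightarrow> 'a) set ring" and h where hom: "ring_hom_cring P S h"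
    and cong: "\<And>x y. x \<in> carrier P \<Longrightarrow> y \<in> carrier P \<Longrightarrow> x \<ominus>\<^bsub>P\<^esub> y \<in> Q \<longleftrightarrow> h x = h y"
    and mem: "\<And>x. x \<in> carrier P \<Longrightarrow> x \<in> Q \<longleftrightarrow> h x = \<zero>\<^bsub>S\<^esub>"
    by (rule P.quotient_homE[OF Q.is_ideal]) (rule that)
  interpret h: ring_hom_cring P S h by (rule hom)
  have sub: "poly_ext ?M \<subseteq> Q" by (rule poly_ext_contraction_subset[OF Q.is_ideal])
  have const: "monom P x 0 \<in> Q \<longleftrightarrow> x \<in> ?M" if "x \<in> carrier R" for x
    using mem_contraction_iff[OF that] by simp
  obtain f where f: "f \<in> Q" "coeff P f (deg R f) \<notin> ?M" "deg R f > 0"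
    and min: "\<And>g. g \<in> Q \<Longrightarrow> deg R g < deg R f \<Longrightarrow> g \<in> poly_ext ?M"
    using min_degE[OF Q ne] by blast
  have fc: "f \<in> carrier P" using f Q.Icarr by blast
  have hf: "h f = \<zero>\<^bsub>S\<^esub>" using mem[OF fc] f by simp
  let ?m = "deg R f"
  define a where "a = coeff P f ?m"
  have a: "a \<in> carrier R" "a \<notin> ?M" using f fc by (simp_all add: a_def)
  let ?T = "\<lambda>t. t \<in> carrier P \<and> t \<notin> Q \<and> (\<exists>g\<in>carrier P. h t = h s \<otimes>\<^bsub>S\<^esub> h g)"
  have "?T s" using s by (auto intro!: bexI[of _ "\<one>\<^bsub>P\<^esub>"])
  then obtain t where t: "?T t" and tmin: "\<And>g. ?T g \<Longrightarrow> deg R t \<le> deg R g"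
    using ex_has_least_nat[of ?T s "deg R"] by blast
  have tc: "t \<in> carrier P" and tQ: "t \<notin> Q" using t by auto
  obtain g where g: "g \<in> carrier P" "h t = h s \<otimes>\<^bsub>S\<^esub> h g" using t by blast
  define l where "l = coeff P t (deg R t)"
  have lc: "l \<in> carrier R" using tc by (simp add: l_def)
  \<comment> \<open>Otherwise \<open>t\<close> lies in M[X], hence in \<open>Q\<close>, or removing
    its leading term preserves \<open>?T\<close> and lowers the degree.\<close>
  have l: "l \<notin> ?M"
  proof
    assume "l \<in> ?M"
    then consider "t \<in> poly_ext ?M"
      | t' where "t' \<in> carrier P" "t \<ominus>\<^bsub>P\<^esub> t' \<in> poly_ext ?M" "deg R t' < deg R t"
      using deg_less_of_leading_coeff_mem[OF M.is_ideal tc] unfolding l_def by blast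
    thus False
    proof cases
      case 1
      thus False using sub tQ by blast
    next
      case 2
      have "h t = h t'" using cong[OF tc 2(1)] 2(2) sub by blast
      hence "?T t'" using 2(1) t mem tc by auto
      thus False using tmin[of t'] 2(3) by simp
    qed
  qed
  have nz: "x \<noteq> \<zero>\<^bsub>P\<^esub>" if "x \<notin> Q" for x using that Q.zero_closed by blast
  have fn: "f \<noteq> \<zero>\<^bsub>P\<^esub>" using f(2) M.zero_closed by auto
  have pow: "monom P (x [^] (k::nat)) 0 \<notin> Q" if "x \<in> carrier R" "x \<notin> ?M" for x k
    using that M.pow_mem_iff[of x k] const[of "x [^] k"] by auto
  have prime: "x \<otimes>\<^bsub>P\<^esub> y \<notin> Q" if "x \<in> carrier P" "y \<in> carrier P" "x \<notin> Q" "y \<notin> Q" for x y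
    using that Q.I_prime by blast
  \<comment> \<open>\<open>t\<close> has least degree in \<open>((s) + Q) - Q\<close>; reducing \<open>s\<close> by \<open>f\<close>, then \<open>f\<close> by \<open>t\<close>, shows it is constant.\<close>
  have deg_t: "deg R t < ?m"
  proof -
    obtain q r and k :: nat where qr: "q \<in> carrier P" "r \<in> carrier P"
      "a [^] k \<odot>\<^bsub>P\<^esub> s = f \<otimes>\<^bsub>P\<^esub> q \<oplus>\<^bsub>P\<^esub> r" "r = \<zero>\<^bsub>P\<^esub> \<or> deg R r < ?m"
      using long_div_theorem[OF fc s(1) fn] unfolding a_def by blast
    let ?c = "monom P (a [^] k) 0"
    have cc: "?c \<in> carrier P" using a by simp
    have "?c \<otimes>\<^bsub>P\<^esub> s = f \<otimes>\<^bsub>P\<^esub> q \<oplus>\<^bsub>P\<^esub> r"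
      unfolding qr(3)[symmetric] using a s by (intro monom_mult_is_smult) auto
    hence "h (?c \<otimes>\<^bsub>P\<^esub> s) = h (f \<otimes>\<^bsub>P\<^esub> q \<oplus>\<^bsub>P\<^esub> r)" by simp
    hence hr: "h ?c \<otimes>\<^bsub>S\<^esub> h s = h r" using qr s fc cc hf by simp
    have "h (?c \<otimes>\<^bsub>P\<^esub> s) = h r" using hr cc s by simp
    hence "r \<notin> Q" using mem[OF qr(2)] mem[of "?c \<otimes>\<^bsub>P\<^esub> s"] prime[OF cc s(1) pow[OF a] s(2)] cc s by simp
    moreover have "h r = h s \<otimes>\<^bsub>S\<^esub> h ?c" unfolding hr[symmetric] using cc s by (simp add: h.S.m_comm)
    ultimately have "?T r" using qr(2) cc by blast
    thus ?thesis using tmin[of r] qr(4) nz[OF \<open>r \<notin> Q\<close>] by simp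
  qed
  have "deg R t = 0"
  proof (rule ccontr)
    assume d: "deg R t \<noteq> 0"
    obtain q r and k :: nat where qr: "q \<in> carrier P" "r \<in> carrier P"
      "l [^] k \<odot>\<^bsub>P\<^esub> f = t \<otimes>\<^bsub>P\<^esub> q \<oplus>\<^bsub>P\<^esub> r" "r = \<zero>\<^bsub>P\<^esub> \<or> deg R r < deg R t"
      using long_div_theorem[OF tc fc nz[OF tQ]] unfolding l_def by blast
    let ?F = "l [^] k \<odot>\<^bsub>P\<^esub> f"
    have Fe: "?F = monom P (l [^] k) 0 \<otimes>\<^bsub>P\<^esub> f" using lc fc by (simp add: monom_mult_is_smult)
    have Fc: "?F \<in> carrier P" using lc fc by simp
    have "h ?F = \<zero>\<^bsub>S\<^esub>" unfolding Fe using lc fc hf by simp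
    hence hr: "h t \<otimes>\<^bsub>S\<^esub> h q \<oplus>\<^bsub>S\<^esub> h r = \<zero>\<^bsub>S\<^esub>" using qr tc by simp
    have "h r \<oplus>\<^bsub>S\<^esub> h t \<otimes>\<^bsub>S\<^esub> h q = \<zero>\<^bsub>S\<^esub>" using hr qr tc by (simp add: h.S.a_comm)
    hence hr': "h r = \<ominus>\<^bsub>S\<^esub> (h t \<otimes>\<^bsub>S\<^esub> h q)" using qr tc by (intro h.S.sum_zero_eq_neg) auto
    \<comment> \<open>\<open>r\<close> is congruent modulo \<open>Q\<close> to a multiple of
      \<open>t\<close>, hence of \<open>s\<close>, and is smaller than \<open>t\<close>; minimality
      of \<open>t\<close> leaves only this possibility.\<close>
    have rQ: "r \<in> Q"
    proof (rule ccontr)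
      assume r: "r \<notin> Q"
      have "h r = h s \<otimes>\<^bsub>S\<^esub> h (\<ominus>\<^bsub>P\<^esub> (g \<otimes>\<^bsub>P\<^esub> q))"
        unfolding hr' g(2) using g(1) qr s(1) by (simp add: h.S.m_assoc h.S.r_minus)
      moreover have "\<ominus>\<^bsub>P\<^esub> (g \<otimes>\<^bsub>P\<^esub> q) \<in> carrier P" using g(1) qr by simp
      ultimately have "?T r" using r qr(2) by blast
      thus False using tmin[of r] qr(4) nz[OF r] by simp
    qed
    hence "h r = \<zero>\<^bsub>S\<^esub>" using mem[OF qr(2)] by simp
    hence "h (t \<otimes>\<^bsub>P\<^esub> q) = \<zero>\<^bsub>S\<^esub>" using hr qr tc by simp
    hence "t \<otimes>\<^bsub>P\<^esub> q \<in> Q" using mem[of "t \<otimes>\<^bsub>P\<^esub> q"] tc qr by simp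
    hence qQ: "q \<in> Q" using prime[OF tc qr(1) tQ] by blast
    have tq: "t \<otimes>\<^bsub>P\<^esub> q \<in> carrier P" using tc qr by simp
    have rm: "coeff P r j = \<zero>" if "j \<ge> ?m" for j
      using qr(2,4) that deg_t deg_aboveD[OF _ qr(2), of j] by auto
    have co: "l [^] k \<otimes> coeff P f j = coeff P (t \<otimes>\<^bsub>P\<^esub> q) j" if "j \<ge> ?m" for j
    proof -
      have "coeff P ?F j = coeff P (t \<otimes>\<^bsub>P\<^esub> q) j \<oplus> coeff P r j"
        unfolding qr(3) using tq qr(2) by (simp del: coeff_mult)
      thus ?thesis using rm[OF that] coeff_closed[OF tq] lc fc by (simp del: coeff_mult)
    qed
    \<comment> \<open>From degree \<open>?m\<close> on, t q agrees with l^k f. So t q has degree at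
      most \<open>?m\<close>, and as \<open>t\<close> is not constant, \<open>q\<close> has smaller
      degree and falls under the minimality of \<open>f\<close>. Then l^k a, the coefficient of t q
      in degree \<open>?m\<close>, lies in \<open>?M\<close>, which is absurd.\<close>
    have "q \<in> poly_ext ?M"
    proof (cases "q = \<zero>\<^bsub>P\<^esub>")
      case True
      thus ?thesis by (simp add: poly_ext_def M.zero_closed)
    next
      case False
      have "deg R (t \<otimes>\<^bsub>P\<^esub> q) \<le> ?m"
      proof (rule deg_aboveI[OF _ tq])
        fix j assume j: "?m < j"
        show "coeff P (t \<otimes>\<^bsub>P\<^esub> q) j = \<zero>"
          using co[of j] j deg_aboveD[OF j fc] lc by (simp del: coeff_mult)
      qed
      hence "deg R t + deg R q \<le> ?m" using deg_mult[OF nz[OF tQ] False tc qr(1)] by simp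
      thus ?thesis using d min[OF qQ] by simp
    qed
    hence "coeff P (t \<otimes>\<^bsub>P\<^esub> q) ?m \<in> ?M"
      using coeff_poly_ext poly_ext_mult_carrier(2)[OF M.is_ideal _ tc] by blast
    hence "l [^] k \<otimes> a \<in> ?M" using co[of ?m] by (simp add: a_def del: coeff_mult)
    hence "l [^] k \<in> ?M" using M.I_prime[of "l [^] k" a] a lc by auto
    thus False using M.pow_mem_iff lc l by blast
  qed
  hence "t = monom P l 0" using deg_zero_impl_monom[OF tc] by (simp add: l_def)
  hence "h (monom P l 0) = h (s \<otimes>\<^bsub>P\<^esub> g)" using g s by simp
  hence "monom P l 0 \<ominus>\<^bsub>P\<^esub> s \<otimes>\<^bsub>P\<^esub> g \<in> Q" using cong[of "monom P l 0" "s \<otimes>\<^bsub>P\<^esub> g"] lc s g by simp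
  thus ?thesis using l lc g(1) by blast
qed

lemma G_witness_contraction:
  assumes Q: "primeideal Q P" and s: "G_witness P Q s"
  shows "\<exists>s0. G_witness R (contraction R Q) s0"
proof (cases "Q \<subseteq> poly_ext (contraction R Q)")
  case True
  thus ?thesis by (rule G_witness_contraction_extended[OF Q _ s])
next
  case False
  interpret Q: primeideal Q P by fact
  let ?M = "contraction R Q"
  interpret M: primeideal ?M R by (rule primeideal_contraction[OF Q])
  obtain S :: "(nat \<Rightarrow> 'a) set ring" and h where hom: "ring_hom_cring P S h"
    and cong: "\<And>x y. x \<in> carrier P \<Longrightarrow> y \<in> carrier P \<Longrightarrow> x \<ominus>\<^bsub>P\<^esub> y \<in> Q \<longleftrightarrow> h x = h y"
    and mem: "\<And>x. x \<in> carrier P \<Longrightarrow> x \<in> Q \<longleftrightarrow> h x = \<zero>\<^bsub>S\<^esub>"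
    by (rule P.quotient_homE[OF Q.is_ideal]) (rule that)
  interpret h: ring_hom_cring P S h by (rule hom)
  obtain f where f: "f \<in> Q" "coeff P f (deg R f) \<notin> ?M" "deg R f > 0"
    and min: "\<And>g. g \<in> Q \<Longrightarrow> deg R g < deg R f \<Longrightarrow> g \<in> poly_ext ?M"
    using min_degE[OF Q False] by blast
  have fc: "f \<in> carrier P" using f Q.Icarr by blast
  have hf: "h f = \<zero>\<^bsub>S\<^esub>" using mem[OF fc] f by simp
  let ?m = "deg R f"
  define a where "a = coeff P f ?m"
  have a: "a \<in> carrier R" "a \<notin> ?M" using f fc by (simp_all add: a_def)
  have sc: "s \<in> carrier P" "s \<notin> Q" using s by (auto simp: G_witness_def)
  obtain c u where c: "c \<in> carrier R" "c \<notin> ?M" and u: "u \<in> carrier P"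
    and cu: "monom P c 0 \<ominus>\<^bsub>P\<^esub> s \<otimes>\<^bsub>P\<^esub> u \<in> Q"
    using exists_const_mem_ideal_add[OF Q False sc] by blast
  have hc: "h (monom P c 0) = h s \<otimes>\<^bsub>S\<^esub> h u" using cong[of "monom P c 0" "s \<otimes>\<^bsub>P\<^esub> u"] c u sc cu by simp
  have fn: "f \<noteq> \<zero>\<^bsub>P\<^esub>" using f(2) M.zero_closed by auto
  have "\<exists>n::nat. \<exists>e\<in>carrier R. d \<otimes> e \<ominus> (a \<otimes> c) [^] n \<in> ?M" if d: "d \<in> carrier R - ?M" for d
  proof -
    have dc: "d \<in> carrier R" using d by simp
    have "monom P d 0 \<in> carrier P" "monom P d 0 \<notin> Q"
      using d mem_contraction_iff[of d Q] monom_closed[of d 0] by blast+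
    from G_witnessD[OF s this] obtain n :: nat and e
      where e: "e \<in> carrier P" "monom P d 0 \<otimes>\<^bsub>P\<^esub> e \<ominus>\<^bsub>P\<^esub> s [^]\<^bsub>P\<^esub> n \<in> Q" .
    let ?d = "monom P d 0" and ?c = "monom P c 0"
    have cc: "?d \<in> carrier P" "?c \<in> carrier P" using dc c by simp_all
    have he: "h ?d \<otimes>\<^bsub>S\<^esub> h e = h s [^]\<^bsub>S\<^esub> n"
      using cong[of "?d \<otimes>\<^bsub>P\<^esub> e" "s [^]\<^bsub>P\<^esub> n"] e cc sc by simp
    \<comment> \<open>Multiplying d e = s^n by u^n replaces \<open>s\<close> by the constant
      \<open>c\<close>, with \<open>?g\<close> as the new cofactor of \<open>d\<close>.\<close>
    let ?g = "e \<otimes>\<^bsub>P\<^esub> u [^]\<^bsub>P\<^esub> n"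
    have gc: "?g \<in> carrier P" using e u by simp
    have "h ?c [^]\<^bsub>S\<^esub> n = h s [^]\<^bsub>S\<^esub> n \<otimes>\<^bsub>S\<^esub> h u [^]\<^bsub>S\<^esub> n"
      unfolding hc using sc u by (simp add: h.S.nat_pow_distrib)
    also have "\<dots> = h ?d \<otimes>\<^bsub>S\<^esub> h ?g"
      unfolding he[symmetric] using e u cc by (simp add: h.S.m_assoc)
    finally have hcn: "h ?c [^]\<^bsub>S\<^esub> n = h ?d \<otimes>\<^bsub>S\<^esub> h ?g" .
    obtain q r and k :: nat where qr: "q \<in> carrier P" "r \<in> carrier P"
      "a [^] k \<odot>\<^bsub>P\<^esub> ?g = f \<otimes>\<^bsub>P\<^esub> q \<oplus>\<^bsub>P\<^esub> r" "r = \<zero>\<^bsub>P\<^esub> \<or> deg R r < ?m"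
      using long_div_theorem[OF fc gc fn] unfolding a_def by blast
    let ?a = "monom P (a [^] k) 0"
    have ac: "?a \<in> carrier P" using a by simp
    have "?a \<otimes>\<^bsub>P\<^esub> ?g = f \<otimes>\<^bsub>P\<^esub> q \<oplus>\<^bsub>P\<^esub> r"
      unfolding qr(3)[symmetric] using a gc by (intro monom_mult_is_smult) auto
    hence "h (?a \<otimes>\<^bsub>P\<^esub> ?g) = h (f \<otimes>\<^bsub>P\<^esub> q \<oplus>\<^bsub>P\<^esub> r)" by simp
    hence "h (?a \<otimes>\<^bsub>P\<^esub> ?g) = h r" using qr fc hf by simp
    hence hr: "h ?a \<otimes>\<^bsub>S\<^esub> h ?g = h r" by (simp only: h.hom_mult[OF ac gc])
    \<comment> \<open>The constant that is congruent to d r modulo \<open>Q\<close>, where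
      \<open>r\<close> is the cofactor reduced by \<open>f\<close>.\<close>
    define x where "x = a [^] k \<otimes> c [^] n"
    have xc: "x \<in> carrier R" using a c by (simp add: x_def)
    have "monom P x 0 = ?a \<otimes>\<^bsub>P\<^esub> ?c [^]\<^bsub>P\<^esub> n"
      using monom_mult[of "a [^] k" "c [^] n" 0 0] monom_pow[of c 0 n] a c by (simp add: x_def)
    hence "h (monom P x 0) = h ?a \<otimes>\<^bsub>S\<^esub> h ?c [^]\<^bsub>S\<^esub> n" using ac cc by simp
    also have "\<dots> = h ?d \<otimes>\<^bsub>S\<^esub> (h ?a \<otimes>\<^bsub>S\<^esub> h ?g)"
      unfolding hcn
      by (rule h.S.m_lcomm) (use ac cc gc in \<open>auto simp only: intro!: h.hom_closed\<close>)
    also have "\<dots> = h (?d \<otimes>\<^bsub>P\<^esub> r)" unfolding hr using cc qr by simp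
    finally have "monom P x 0 \<ominus>\<^bsub>P\<^esub> ?d \<otimes>\<^bsub>P\<^esub> r \<in> Q"
      using cong[of "monom P x 0" "?d \<otimes>\<^bsub>P\<^esub> r"] xc cc qr by simp
    moreover have dr: "?d \<otimes>\<^bsub>P\<^esub> r \<in> carrier P" using cc qr by simp
    moreover have cof: "coeff P (monom P x 0 \<ominus>\<^bsub>P\<^esub> ?d \<otimes>\<^bsub>P\<^esub> r) j
        = (if j = 0 then x else \<zero>) \<ominus> d \<otimes> coeff P r j" for j
      using xc dr dc qr(2) by (simp add: monom_0_mult_coeff del: coeff_mult)
    \<comment> \<open>\<open>r\<close> has degree below \<open>?m\<close>, and the constant
      \<open>x\<close> does not reach degree \<open>?m > 0\<close>. Minimality of \<open>f\<close>
      thus forces this element of \<open>Q\<close> into M[X], and constant coefficients can be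
      compared modulo \<open>?M\<close>.\<close>
    have "deg R (monom P x 0 \<ominus>\<^bsub>P\<^esub> ?d \<otimes>\<^bsub>P\<^esub> r) \<le> ?m - 1"
    proof (rule deg_aboveI)
      fix j assume "?m - 1 < j"
      hence j: "j \<ge> ?m" "j > 0" by auto
      hence "coeff P r j = \<zero>" using qr(2,4) deg_aboveD[OF _ qr(2), of j] by auto
      thus "coeff P (monom P x 0 \<ominus>\<^bsub>P\<^esub> ?d \<otimes>\<^bsub>P\<^esub> r) j = \<zero>"
        unfolding cof using j dc by (simp add: a_minus_def)
    qed (use xc dr in simp)
    ultimately have "monom P x 0 \<ominus>\<^bsub>P\<^esub> ?d \<otimes>\<^bsub>P\<^esub> r \<in> poly_ext ?M"
      using min f(3) by simp
    hence 1: "x \<ominus> d \<otimes> coeff P r 0 \<in> ?M" using coeff_poly_ext[of _ ?M 0] cof[of 0] by force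
    define y where "y = coeff P r 0"
    have yc: "y \<in> carrier R" using qr(2) by (simp add: y_def)
    \<comment> \<open>\<open>z\<close> evens out the exponents \<open>k\<close> of \<open>a\<close>
      and \<open>n\<close> of \<open>c\<close> to \<open>k + n\<close>, which makes a power of
      \<open>a \<otimes> c\<close>.\<close>
    define z where "z = a [^] n \<otimes> c [^] k"
    have zc: "z \<in> carrier R" using a c by (simp add: z_def)
    have "\<ominus> ((x \<ominus> d \<otimes> y) \<otimes> z) \<in> ?M"
      using M.I_r_closed[OF 1 zc] unfolding y_def by (rule M.a_inv_closed)
    moreover have "\<ominus> ((x \<ominus> d \<otimes> y) \<otimes> z) = d \<otimes> (y \<otimes> z) \<ominus> x \<otimes> z"
      using xc yc zc dc by (simp add: a_minus_def R.l_distr R.l_minus R.minus_add R.m_assoc R.a_comm)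
    moreover have "x \<otimes> z = (a \<otimes> c) [^] (k + n)"
    proof -
      have "x \<otimes> z = (a [^] k \<otimes> a [^] n) \<otimes> (c [^] k \<otimes> c [^] n)"
        unfolding x_def z_def using a c by (simp add: R.m_ac)
      also have "\<dots> = a [^] (k + n) \<otimes> c [^] (k + n)" using a c by (simp add: R.nat_pow_mult)
      finally show ?thesis using a c by (simp add: R.nat_pow_distrib)
    qed
    ultimately have "d \<otimes> (y \<otimes> z) \<ominus> (a \<otimes> c) [^] (k + n) \<in> ?M" by simp
    thus ?thesis using yc zc by (intro exI[of _ "k + n"] bexI[of _ "y \<otimes> z"]) auto
  qed
  moreover have "a \<otimes> c \<notin> ?M" using M.I_prime[of a c] a c by blast
  ultimately show ?thesis using a c unfolding G_witness_def by (intro exI[of _ "a \<otimes> c"]) auto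
qed

section \<open>Maximal contractions and power stability\<close>

lemma contraction_G_ideal_maximal:
  assumes "hilbert_ring R" "G_ideal Q P"
  shows "maximalideal (contraction R Q) R"
proof -
  have Q: "primeideal Q P" using assms(2) by (simp add: G_ideal_def)
  obtain s where "G_witness P Q s" using assms(2) G_ideal_iff[OF Q] by blast
  from G_witness_contraction[OF Q this]
  have "G_ideal (contraction R Q) R"
    by (simp add: G_ideal_iff[OF primeideal_contraction[OF Q]])
  \<comment> \<open>The Hilbert property of \<open>R\<close> is applied here and nowhere
    else.\<close>
  thus ?thesis using assms(1) by (simp add: hilbert_ring_def)
qed

lemma contraction_pow_G_ideal:
  assumes "hilbert_ring R" "G_ideal Q P"
  shows "contraction R (Q [^]\<^bsub>ideals_set P\<^esub> (t::nat)) \<subseteq> contraction R Q [^]\<^bsub>ideals_set R\<^esub> t"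
proof -
  have max: "maximalideal (contraction R Q) R" by (rule contraction_G_ideal_maximal[OF assms])
  have Q: "primeideal Q P" using assms(2) by (simp add: G_ideal_def)
  show ?thesis
    by (rule maximal_contraction_generator[OF Q max])
      (rule contraction_ideal_pow_subset[OF maximalideal.axioms(1)[OF max] primeideal.axioms(1)[OF Q]])
qed

lemma power_stable_Inter_G_ideals:
  assumes "hilbert_ring R" "finite F" "\<And>Q. Q \<in> F \<Longrightarrow> G_ideal Q P"
    and I: "ideal I P" "I = carrier P \<inter> \<Inter>F"
  shows "contraction R (I [^]\<^bsub>ideals_set P\<^esub> (t::nat)) = contraction R I [^]\<^bsub>ideals_set R\<^esub> t"
proof (rule antisym)
  \<comment> \<open>Distinct members of \<open>F\<close> may have the same contraction; the image
    set counts it once, as comaximality requires distinct maximal ideals.\<close>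
  let ?M = "contraction R ` F"
  have "contraction R (I [^]\<^bsub>ideals_set P\<^esub> t)
      \<subseteq> carrier R \<inter> (\<Inter>J\<in>?M. J [^]\<^bsub>ideals_set R\<^esub> t)"
  proof -
    have "contraction R (I [^]\<^bsub>ideals_set P\<^esub> t) \<subseteq> contraction R Q [^]\<^bsub>ideals_set R\<^esub> t"
      if "Q \<in> F" for Q
    proof -
      have "I \<subseteq> Q" using I(2) that by blast
      hence "I [^]\<^bsub>ideals_set P\<^esub> t \<subseteq> Q [^]\<^bsub>ideals_set P\<^esub> t" by (rule ideal_pow_mono)
      hence "contraction R (I [^]\<^bsub>ideals_set P\<^esub> t) \<subseteq> contraction R (Q [^]\<^bsub>ideals_set P\<^esub> t)"
        unfolding contraction_eq by blast
      also have "\<dots> \<subseteq> contraction R Q [^]\<^bsub>ideals_set R\<^esub> t"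
        by (rule contraction_pow_G_ideal[OF assms(1) assms(3)[OF that]])
      finally show ?thesis .
    qed
    thus ?thesis unfolding contraction_eq by blast
  qed
  also have "\<dots> \<subseteq> (carrier R \<inter> \<Inter>?M) [^]\<^bsub>ideals_set R\<^esub> t"
    using assms(2,3) contraction_G_ideal_maximal[OF assms(1)]
    by (intro R.Inter_maximalideal_pow_subset) auto
  also have "carrier R \<inter> \<Inter>?M = contraction R I"
    unfolding I(2) contraction_eq using monom_closed by blast
  finally show "contraction R (I [^]\<^bsub>ideals_set P\<^esub> t) \<subseteq> contraction R I [^]\<^bsub>ideals_set R\<^esub> t" .
  show "contraction R I [^]\<^bsub>ideals_set R\<^esub> t \<subseteq> contraction R (I [^]\<^bsub>ideals_set P\<^esub> t)"
    by (rule contraction_pow_subset[OF I(1)])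
qed

end

theorem theorem3p14:
  fixes R :: "('a, 'b) ring_scheme" and I :: "(nat \<Rightarrow> 'a) set"
    and F :: "(nat \<Rightarrow> 'a) set set"
  assumes "domain R" and "hilbert_ring R"
    and "radical_ideal I (UP R)"
    and "finite F" and "\<forall>Q\<in>F. G_ideal Q (UP R)" and "I = carrier (UP R) \<inter> \<Inter>F"
  shows "power_stable R I"
proof -
  interpret UP_domain R "UP R" by (rule UP_domain.intro[OF assms(1)])
  have I: "ideal I (UP R)" using assms(3) by (simp add: radical_ideal_def)
  show ?thesis
    unfolding power_stable_def
    using I power_stable_Inter_G_ideals[OF assms(2,4) bspec[OF assms(5)] I assms(6)] by blast
qed

end
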